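(* Let $N\ge2$, $0<L<\infty$, and $0<m<p<\min\{p_S,1\}$, where $p_S=\frac{m(N+2)}{N-2}$ if $N\ge3$ and $p_S=\infty$ if $N=2$. If $u$ is a solution to $$u_t=\Delta u^m+\mathbf 1_{B_L}(x)\,u^p\quad\text{in }\mathbb R^N\times(0,\infty),\qquad u(x,0)=u_0(x),$$ with global grow-up, then, as $t\to\infty$, $$u(x,t)\sim t^{\frac1{1-p}}$$ for every $|x|<L$.
   Context: $B_L=\{x\in\mathbb R^N:|x|<L\}$. The initial datum $u_0\in L^1(\mathbb R^N)\cap L^\infty(\mathbb R^N)$ is continuous, nonnegative and nontrivial; if $p<1$ it is moreover assumed strictly positive on $\overline{B_L}$ (to guarantee uniqueness). The solution is the unique nonnegative (weak) solution, bounded in $\mathbb R^N\times[0,t]$ for every $t$ smaller than its maximal existence time. A solution has global grow-up if it is defined for all times and $\lim_{t\to\infty}u(x,t)=\infty$ uniformly on compact subsets of $\mathbb R^N$. The symbol $f\sim g$ as $t\to\infty$ means that there are constants $0<c_1\le c_2<\infty$ with $c_1\le f/g\le c_2$ for all large $t$ (here the constants may depend on $x$ and $u$). *)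

theory Defs
  imports "HOL-Analysis.Analysis"
begin

primrec Ck_function :: "nat \<Rightarrow> ('a::euclidean_space \<Rightarrow> real) \<Rightarrow> bool" where
  "Ck_function 0 f \<longleftrightarrow> continuous_on UNIV f"
| "Ck_function (Suc k) f \<longleftrightarrow>
     (\<forall>z. f differentiable (at z)) \<and>
     (\<forall>v. Ck_function k (\<lambda>z. frechet_derivative f (at z) v))"

definition test_function :: "'a::euclidean_space set \<Rightarrow> ('a \<Rightarrow> real) \<Rightarrow> bool" where
  "test_function S \<phi> \<longleftrightarrow>
     (\<forall>k. Ck_function k \<phi>) \<and>
     compact (closure {z. \<phi> z \<noteq> 0}) \<and> closure {z. \<phi> z \<noteq> 0} \<subseteq> S"

definition time_deriv :: "((real^'n) \<times> real \<Rightarrow> real) \<Rightarrow> (real^'n) \<times> real \<Rightarrow> real" where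
  "time_deriv \<phi> z = frechet_derivative \<phi> (at z) (0, 1)"

definition space_grad :: "((real^'n) \<times> real \<Rightarrow> real) \<Rightarrow> (real^'n) \<times> real \<Rightarrow> real^'n" where
  "space_grad \<phi> z = (\<chi> i. frechet_derivative \<phi> (at z) (axis i 1, 0))"

text \<open>\<open>V\<close> is the weak gradient with respect to \<open>x\<close> of \<open>w\<close> on
  \<open>\<real>\<^sup>N \<times> (0,\<infinity>)\<close>, and it lies in \<open>L\<^sup>2\<close> on compact subsets of \<open>\<real>\<^sup>N \<times> [0,\<infinity>)\<close>.\<close>

definition weak_space_grad ::
  "((real^'n) \<times> real \<Rightarrow> real) \<Rightarrow> ((real^'n) \<times> real \<Rightarrow> real^'n) \<Rightarrow> bool" where
  "weak_space_grad w V \<longleftrightarrow>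
     V \<in> borel_measurable borel \<and>
     (\<forall>K. compact K \<longrightarrow> K \<subseteq> UNIV \<times> {0..} \<longrightarrow>
        set_integrable lborel K (\<lambda>z. (norm (V z))\<^sup>2)) \<and>
     (\<forall>\<phi>. test_function (UNIV \<times> {0<..}) \<phi> \<longrightarrow>
        set_lebesgue_integral lborel (UNIV \<times> {0<..}) (\<lambda>z. w z *\<^sub>R space_grad \<phi> z) =
        - set_lebesgue_integral lborel (UNIV \<times> {0<..}) (\<lambda>z. \<phi> z *\<^sub>R V z))"

definition initial_datum :: "real \<Rightarrow> real \<Rightarrow> (real^'n \<Rightarrow> real) \<Rightarrow> bool" where
  "initial_datum p L u0 \<longleftrightarrow>
     integrable lborel u0 \<and> bounded (range u0) \<and> continuous_on UNIV u0 \<and>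
     (\<forall>x. 0 \<le> u0 x) \<and> (\<exists>x. u0 x \<noteq> 0) \<and>
     (p < 1 \<longrightarrow> (\<forall>x \<in> closure (ball 0 L). 0 < u0 x))"

text \<open>Global nonnegative weak solutions of
  \<open>u\<^sub>t = \<Delta>u\<^sup>m + \<one>\<^bsub>B\<^sub>L\<^esub> u\<^sup>p\<close>, \<open>u(\<cdot>,0) = u\<^sub>0\<close>, locally bounded in time; values \<open>u x t\<close>
  with \<open>t < 0\<close> are irrelevant. Bounded weak solutions are only determined up to null sets, so
  \<open>u\<close> is taken to be the continuous representative; this gives its pointwise values a meaning.
  Test functions need not vanish at \<open>t = 0\<close>, hence the last integral.\<close>

definition global_weak_solution ::
  "real \<Rightarrow> real \<Rightarrow> real \<Rightarrow> (real^'n \<Rightarrow> real) \<Rightarrow> (real^'n \<Rightarrow> real \<Rightarrow> real) \<Rightarrow> bool" where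
  "global_weak_solution m p L u0 u \<longleftrightarrow>
     (\<forall>x. \<forall>t\<ge>0. 0 \<le> u x t) \<and>
     (\<forall>t\<ge>0. bounded {u x s | x s. 0 \<le> s \<and> s \<le> t}) \<and>
     continuous_on (UNIV \<times> {0..}) (\<lambda>(x, t). u x t) \<and>
     (\<forall>x. u x 0 = u0 x) \<and>
     (\<exists>V. weak_space_grad (\<lambda>(x, t). u x t powr m) V \<and>
        (\<forall>\<phi>. test_function UNIV \<phi> \<longrightarrow>
           set_lebesgue_integral lborel (UNIV \<times> {0<..})
             (\<lambda>(x, t). u x t * time_deriv \<phi> (x, t)
                       - V (x, t) \<bullet> space_grad \<phi> (x, t)
                       + indicator (ball 0 L) x * u x t powr p * \<phi> (x, t))
           + (LINT x|lborel. u0 x * \<phi> (x, 0)) = 0))"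

text \<open>As \<open>u\<close> is a total function, existence for all times is expressed by
  \<^const>\<open>global_weak_solution\<close>.\<close>

definition tends_to_infinity_locally_uniformly :: "(real^'n \<Rightarrow> real \<Rightarrow> real) \<Rightarrow> bool" where
  "tends_to_infinity_locally_uniformly u \<longleftrightarrow>
     (\<forall>K. compact K \<longrightarrow> (\<forall>M. \<forall>\<^sub>F t in at_top. \<forall>x\<in>K. M < u x t))"

definition global_grow_up ::
  "real \<Rightarrow> real \<Rightarrow> real \<Rightarrow> (real^'n \<Rightarrow> real) \<Rightarrow> (real^'n \<Rightarrow> real \<Rightarrow> real) \<Rightarrow> bool" where
  "global_grow_up m p L u0 u \<longleftrightarrow>
     global_weak_solution m p L u0 u \<and> tends_to_infinity_locally_uniformly u"

definition sobolev_exponent :: "nat \<Rightarrow> real \<Rightarrow> ereal" where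
  "sobolev_exponent N m =
     (if N \<ge> 3 then ereal (m * (real N + 2) / (real N - 2)) else \<infinity>)"

definition comparable_at_top :: "(real \<Rightarrow> real) \<Rightarrow> (real \<Rightarrow> real) \<Rightarrow> bool" where
  "comparable_at_top f g \<longleftrightarrow>
     (\<exists>c1 c2. 0 < c1 \<and> c1 \<le> c2 \<and> (\<forall>\<^sub>F t in at_top. c1 \<le> f t / g t \<and> f t / g t \<le> c2))"

end

theory Submission
  imports Defs
begin

text \<open>Write \<open>w = u\<^sup>m\<close> and let \<open>A\<close> be the average of \<open>w\<close> over \<open>[t, t + h]\<close>, mollified at a scale much
  smaller than \<open>h\<close>. Testing the equation with the averaging kernel shows that, up to small errors,
  \<open>\<partial>\<^sub>t A = (w(t + h) - w(t)) / h\<close> and \<open>\<Delta>A + \<one>\<^bsub>B\<^sub>L\<^esub> u\<^sup>p = (u(t + h) - u(t)) / h\<close>. As \<open>u = w\<^bsup>1/m\<^esup>\<close> with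
  \<open>1/m > 1\<close>, convexity compares the two difference quotients, so the maximum principle can be applied
  to the smooth function \<open>A\<close> at its first contact with an explicit barrier; no regularity theory for
  \<open>u\<close> is needed. With \<open>S = g\<^sup>m\<close> and \<open>g' = c g\<^sup>p\<close>, hence \<open>g \<sim> t\<^bsup>1/(1-p)\<^esup>\<close>, the barrier from above is
  \<open>S(t) + \<epsilon>|x|\<^sup>2\<close> with \<open>c\<close> large, and the barrier from below is \<open>S(t) (1 - |x|\<^sup>2/R\<^sup>2)\<^sup>2\<close> on a ball of
  radius \<open>R < L\<close> with \<open>c\<close> small. The latter is a subsolution once \<open>S\<close> is large, because \<open>p > m\<close> makes
  the reaction dominate diffusion; grow-up provides a time at which \<open>w\<close> exceeds it.\<close>

section \<open>Smooth functions and mollifiers\<close>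

text \<open>The obstacle is that powers do not commute with averaging: the Laplacian acts on
  \<open>u^m\<close> and the time derivative on \<open>u\<close>, and after mollification the two
  are no longer powers of each other. The average over a time interval of length h repairs this: up
  to small errors and the reaction, its time derivative and its Laplacian are quotients of the
  values of w and u at the same two times, and these values still obey the exact power law.
  Convexity then costs only a factor: the slope is taken at time t in the comparison from above, and
  at t + h in the one from below, where the small variation of w over h keeps it comparable. All
  errors are absolute and are chosen after the end time T, the ball and the barrier. Every T gets
  its own A, while the rate c and the starting value of S are the same for all T. Since S \<ge> 1,
  and the contact value in the comparison from below is at least 1, the inequalities at contact have
  a margin that absorbs the errors.\<close>

lemma Ck_function_SucI:
  assumes "\<And>z. (f has_derivative f' z) (at z)" and "\<And>v. Ck_function k (\<lambda>z. f' z v)"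
  shows "Ck_function (Suc k) f"
proof -
  have "frechet_derivative f (at z) = f' z" for z
    using assms(1) frechet_derivative_at by metis
  moreover have "f differentiable (at z)" for z
    using assms(1) by (auto simp: differentiable_def)
  ultimately show ?thesis using assms(2) by simp
qed

lemma Ck_function_Suc_derivative:
  assumes "Ck_function (Suc k) f"
  shows "(f has_derivative frechet_derivative f (at z)) (at z)"
    and "Ck_function k (\<lambda>z. frechet_derivative f (at z) v)"
  using assms by (auto simp: frechet_derivative_works)

lemma Ck_function_Suc_imp: "Ck_function (Suc k) f \<Longrightarrow> Ck_function k f"
proof (induction k arbitrary: f)
  case 0
  then show ?case
    by (auto intro!: continuous_at_imp_continuous_on differentiable_imp_continuous_within)
next
  case (Suc k)
  then show ?case by (metis Ck_function.simps(2))
qed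

lemma Ck_function_imp_continuous: "Ck_function k f \<Longrightarrow> continuous_on UNIV f"
  by (induction k) (auto dest: Ck_function_Suc_imp simp del: Ck_function.simps(2))

lemma Ck_function_const: "Ck_function k (\<lambda>z. c)"
proof (induction k arbitrary: c)
  case (Suc k)
  show ?case by (rule Ck_function_SucI[where f' = "\<lambda>z v. 0"]) (auto simp: Suc)
qed auto

lemma Ck_function_bounded_linear: "bounded_linear f \<Longrightarrow> Ck_function k f"
proof (cases k)
  case 0
  then show "bounded_linear f \<Longrightarrow> ?thesis" by (simp add: linear_continuous_on)
next
  case (Suc j)
  assume "bounded_linear f"
  then show ?thesis unfolding Suc
    by (intro Ck_function_SucI[where f' = "\<lambda>z v. f v"] bounded_linear_imp_has_derivative Ck_function_const)
qed

lemma Ck_function_add: "Ck_function k f \<Longrightarrow> Ck_function k g \<Longrightarrow> Ck_function k (\<lambda>z. f z + g z)"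
proof (induction k arbitrary: f g)
  case (Suc k)
  show ?case
    by (rule Ck_function_SucI[OF has_derivative_add[OF Suc.prems[THEN Ck_function_Suc_derivative(1)]]])
       (use Suc.prems in \<open>auto intro!: Suc.IH\<close>)
qed (auto intro!: continuous_intros)

lemma Ck_function_mult: "Ck_function k f \<Longrightarrow> Ck_function k g \<Longrightarrow> Ck_function k (\<lambda>z. f z * g z)"
proof (induction k arbitrary: f g)
  case (Suc k)
  note k = Suc.prems[THEN Ck_function_Suc_imp]
  show ?case
    by (rule Ck_function_SucI[OF has_derivative_mult[OF Suc.prems[THEN Ck_function_Suc_derivative(1)]]])
       (use Suc.prems k in \<open>auto intro!: Suc.IH Ck_function_add\<close>)
qed (auto intro!: continuous_intros)

text \<open>The outer function lives on the line, so the chain rule writes a derivative as a scalar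
  function of q times a derivative of q. The induction over all f with q fixed closes through the
  product lemma.\<close>

lemma Ck_function_compose:
  fixes f :: "real \<Rightarrow> real"
  shows "Ck_function k f \<Longrightarrow> Ck_function k q \<Longrightarrow> Ck_function k (\<lambda>z. f (q z))"
proof (induction k arbitrary: f)
  case 0
  then show ?case by (auto intro: continuous_on_compose2)
next
  case (Suc k)
  have lin: "frechet_derivative f (at y) v = frechet_derivative f (at y) 1 * v" for y v
  proof -
    have "frechet_derivative f (at y) (v *\<^sub>R 1) = v *\<^sub>R frechet_derivative f (at y) 1"
      by (rule linear_scale[OF has_derivative_linear[OF Ck_function_Suc_derivative(1)[OF Suc.prems(1)]]])
    then show ?thesis by simp
  qed
  show ?case
  proof (rule Ck_function_SucI)
    fix z
    show "((\<lambda>z. f (q z)) has_derivative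
       (\<lambda>v. frechet_derivative f (at (q z)) 1 * frechet_derivative q (at z) v)) (at z)"
      unfolding lin[symmetric]
      using diff_chain_at[OF Ck_function_Suc_derivative(1)[OF Suc.prems(2)]
         Ck_function_Suc_derivative(1)[OF Suc.prems(1)]]
      by (simp add: o_def)
  next
    fix v
    show "Ck_function k (\<lambda>z. frechet_derivative f (at (q z)) 1 * frechet_derivative q (at z) v)"
      by (rule Ck_function_mult[OF Suc.IH[OF Ck_function_Suc_derivative(2)[OF Suc.prems(1)]
            Ck_function_Suc_imp[OF Suc.prems(2)]] Ck_function_Suc_derivative(2)[OF Suc.prems(2)]])
  qed
qed

lemma Ck_function_cmult: "Ck_function k f \<Longrightarrow> Ck_function k (\<lambda>z. c * f z)"
  by (intro Ck_function_mult Ck_function_const)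

lemma Ck_function_shift: "Ck_function k f \<Longrightarrow> Ck_function k (\<lambda>z. f (z - c))"
proof (induction k arbitrary: f)
  case 0
  then show ?case by (auto intro!: continuous_on_compose2[of UNIV f] continuous_intros)
next
  case (Suc k)
  show ?case
  proof (rule Ck_function_SucI)
    fix z
    have "((\<lambda>z. z - c) has_derivative (\<lambda>v. v)) (at z)" by (auto intro!: derivative_eq_intros)
    then show "((\<lambda>z. f (z - c)) has_derivative (\<lambda>v. frechet_derivative f (at (z - c)) v)) (at z)"
      using diff_chain_at[OF _ Ck_function_Suc_derivative(1)[OF Suc.prems]] by (force simp: o_def)
  qed (use Suc in auto)
qed

lemma Ck_function_fst:
  assumes "Ck_function k f"
  shows "Ck_function k (\<lambda>z::'a::euclidean_space \<times> 'b::euclidean_space. f (fst z))"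
  using assms
proof (induction k arbitrary: f)
  case 0
  then show ?case by (auto intro!: continuous_on_compose2[of UNIV f] continuous_intros)
next
  case (Suc k)
  show ?case
  proof (rule Ck_function_SucI)
    fix z :: "'a \<times> 'b"
    have "(fst has_derivative fst) (at z)" by (auto intro!: derivative_eq_intros)
    then show "((\<lambda>z. f (fst z)) has_derivative (\<lambda>v. frechet_derivative f (at (fst z)) (fst v))) (at z)"
      using diff_chain_at[OF _ Ck_function_Suc_derivative(1)[OF Suc.prems]] by (force simp: o_def)
  qed (use Suc in auto)
qed

lemma Ck_function_snd:
  assumes "Ck_function k f"
  shows "Ck_function k (\<lambda>z::'a::euclidean_space \<times> 'b::euclidean_space. f (snd z))"
  using assms
proof (induction k arbitrary: f)
  case 0
  then show ?case by (auto intro!: continuous_on_compose2[of UNIV f] continuous_intros)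
next
  case (Suc k)
  show ?case
  proof (rule Ck_function_SucI)
    fix z :: "'a \<times> 'b"
    have "(snd has_derivative snd) (at z)" by (auto intro!: derivative_eq_intros)
    then show "((\<lambda>z. f (snd z)) has_derivative (\<lambda>v. frechet_derivative f (at (snd z)) (snd v))) (at z)"
      using diff_chain_at[OF _ Ck_function_Suc_derivative(1)[OF Suc.prems]] by (force simp: o_def)
  qed (use Suc in auto)
qed

lemma Ck_function_real_SucI:
  fixes f :: "real \<Rightarrow> real"
  assumes "\<And>s. (f has_real_derivative f' s) (at s)" and "Ck_function k f'"
  shows "Ck_function (Suc k) f"
proof (rule Ck_function_SucI)
  show "(f has_derivative (\<lambda>v. v * f' s)) (at s)" for s
    using assms(1)[of s] by (simp add: has_field_derivative_def mult_commute_abs)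
qed (simp add: Ck_function_cmult assms(2))

section \<open>A flat function and the kernels built from it\<close>

text \<open>The powers of 1/s are carried along so that the family is closed under differentiation:
  a derivative combines the members n + 1 and n + 2, and smoothness of the classical exp(-1/s)
  follows by one induction.\<close>

definition flat_exp :: "nat \<Rightarrow> real \<Rightarrow> real" where
  "flat_exp n s = (if s > 0 then (1 / s) ^ n * exp (- (1 / s)) else 0)"

lemma isCont_flat_exp_0: "isCont (flat_exp n) 0"
proof -
  have "((\<lambda>x::real. x ^ n * exp (- x)) \<longlongrightarrow> 0) at_top"
    using tendsto_power_div_exp_0[of n] by (simp add: exp_minus divide_inverse)
  then have "((\<lambda>s::real. (1 / s) ^ n * exp (- (1 / s))) \<longlongrightarrow> 0) (at_right 0)"
    by (rule filterlim_compose) (use filterlim_inverse_at_top_right in \<open>simp add: inverse_eq_divide\<close>)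
  then have "(flat_exp n \<longlongrightarrow> 0) (at_right 0)"
    by (rule Lim_transform_eventually)
       (auto simp: flat_exp_def eventually_at_filter)
  moreover have "(flat_exp n \<longlongrightarrow> 0) (at_left 0)"
    by (rule Lim_transform_eventually[OF tendsto_const])
       (auto simp: flat_exp_def eventually_at_filter)
  ultimately show ?thesis
    by (simp add: isCont_def filterlim_at_split flat_exp_def)
qed

lemma flat_exp_has_derivative:
  "(flat_exp n has_real_derivative flat_exp (n + 2) s - n * flat_exp (n + 1) s) (at s)"
proof (cases s "0::real" rule: linorder_cases)
  case greater
  have "((\<lambda>s. (1 / s) ^ n * exp (- (1 / s))) has_real_derivative
          flat_exp (n + 2) s - n * flat_exp (n + 1) s) (at s)"
  proof (cases n)
    case (Suc j)
    have "j = 0 \<or> s ^ j = s * s ^ (j - Suc 0)"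
      by (cases j) auto
    with Suc show ?thesis using greater
      by (auto intro!: derivative_eq_intros simp: flat_exp_def field_simps power2_eq_square)
  qed (use greater in \<open>auto intro!: derivative_eq_intros simp: flat_exp_def field_simps power2_eq_square\<close>)
  moreover have "\<forall>\<^sub>F y in nhds s. 0 < y"
    using eventually_nhds_in_open[of "{0<..}" s] greater by simp
  then have "\<forall>\<^sub>F y in nhds s. (1 / y) ^ n * exp (- (1 / y)) = flat_exp n y"
    by eventually_elim (auto simp: flat_exp_def)
  from DERIV_cong_ev[OF refl this refl] show ?thesis using calculation by blast
next
  case less
  have "((\<lambda>s. 0) has_real_derivative flat_exp (n + 2) s - n * flat_exp (n + 1) s) (at s)"
    using less by (auto simp: flat_exp_def)
  moreover have "\<forall>\<^sub>F y in nhds s. y < 0"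
    using eventually_nhds_in_open[of "{..<0}" s] less by simp
  then have "\<forall>\<^sub>F y in nhds s. 0 = flat_exp n y"
    by eventually_elim (auto simp: flat_exp_def)
  from DERIV_cong_ev[OF refl this refl] show ?thesis using calculation by blast
next
  case equal
  have "(flat_exp (n + 1) \<longlongrightarrow> 0) (at 0)"
    \<comment> \<open>At 0 the difference quotient of \<open>flat_exp n\<close> is
      \<open>flat_exp (n + 1)\<close> itself, so the limit of the next member is the
      derivative.\<close>
    using isCont_flat_exp_0[of "n + 1"] by (simp add: isCont_def flat_exp_def)
  then have "((\<lambda>h. (flat_exp n h - flat_exp n 0) / h) \<longlongrightarrow> 0) (at 0)"
    by (rule Lim_transform_eventually)
       (auto simp: flat_exp_def eventually_at_filter field_simps)
  then show ?thesis
    using equal by (simp add: has_field_derivative_iff flat_exp_def)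
qed

lemma Ck_function_flat_exp: "Ck_function k (flat_exp n)"
proof (induction k arbitrary: n)
  case 0
  show ?case using flat_exp_has_derivative
    by (auto intro!: continuous_at_imp_continuous_on DERIV_isCont)
next
  case (Suc k)
  have "Ck_function k (\<lambda>s. flat_exp (n + 2) s + (- real n) * flat_exp (n + 1) s)"
    by (intro Ck_function_add Ck_function_cmult Suc)
  then show ?case using flat_exp_has_derivative
    by (intro Ck_function_real_SucI) (auto simp del: add_2_eq_Suc')
qed

lemma Ck_function_inner_self: "Ck_function k (\<lambda>z. z \<bullet> z)"
proof (cases k)
  case (Suc j)
  show ?thesis unfolding Suc
  proof (rule Ck_function_SucI)
    show "((\<lambda>z::'a. z \<bullet> z) has_derivative (\<lambda>v. 2 * (z \<bullet> v))) (at z)" for z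
      by (auto intro!: derivative_eq_intros simp: inner_commute)
  qed (rule Ck_function_cmult[OF Ck_function_bounded_linear[OF bounded_linear_inner_left]])
qed (auto intro!: continuous_intros)

text \<open>The bump exp(-1/(\<delta>^2 - |y|^2)) divided by its integral. The integral is positive
  because a continuous nonnegative function with zero integral over a box vanishes there, while the
  bump is positive at the origin.\<close>

lemma exists_mollifier:
  assumes "\<delta> > 0"
  obtains P :: "'a::euclidean_space \<Rightarrow> real" where
    "\<And>k. Ck_function k P" "\<And>y. 0 \<le> P y" "\<And>y. \<delta> \<le> norm y \<Longrightarrow> P y = 0" "(P has_integral 1) UNIV"
proof -
  define P0 :: "'a \<Rightarrow> real" where "P0 = (\<lambda>y. flat_exp 0 (\<delta>\<^sup>2 + (- 1) * (y \<bullet> y)))"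
  have sm: "Ck_function k P0" for k
    unfolding P0_def
    by (rule Ck_function_compose[OF Ck_function_flat_exp
          Ck_function_add[OF Ck_function_const Ck_function_cmult[OF Ck_function_inner_self]]])
  have supp: "P0 y = 0" if "\<delta> \<le> norm y" for y
    using power_mono[OF that, of 2] assms by (simp add: P0_def flat_exp_def power2_norm_eq_inner)
  have nonneg: "0 \<le> P0 y" for y by (simp add: P0_def flat_exp_def)
  have pos: "0 < P0 0" using assms by (simp add: P0_def flat_exp_def)
  \<comment> \<open>A cube containing the support: on it continuity alone gives integrability, and
    extension by zero gives the integral over the whole space.\<close>
  define D :: 'a where "D = (\<Sum>i\<in>Basis. \<delta> *\<^sub>R i)"
  have Dsub: "y \<in> cbox (- D) D" if "norm y \<le> \<delta>" for y
    using that Basis_le_norm[of _ y] by (force simp: mem_box D_def abs_le_iff)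
  have cont: "continuous_on S P0" for S
    using sm[of 0] continuous_on_subset by fastforce
  define c where "c = integral (cbox (- D) D) P0"
  have c0: "c \<ge> 0" unfolding c_def by (rule integral_nonneg) (auto simp: nonneg cont integrable_continuous)
  have int: "(P0 has_integral c) (cbox (- D) D)"
    unfolding c_def by (intro integrable_integral integrable_continuous cont)
  have "c \<noteq> 0"
  proof
    assume "c = 0"
    moreover have "box (- D) D \<noteq> {}" using assms by (auto simp: box_ne_empty D_def)
    ultimately have "P0 0 = 0"
      using has_integral_0_cbox_imp_0[OF cont _ _ _ Dsub[of 0]] int nonneg assms by auto
    with pos show False by simp
  qed
  with c0 have c: "c > 0" by simp
  have "(P0 has_integral c) UNIV"
    by (rule has_integral_on_superset[OF int]) (use Dsub supp in force)+
  then have "((\<lambda>y. (1 / c) * P0 y) has_integral (1 / c) * c) UNIV"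
    by (rule has_integral_mult_right)
  then show ?thesis
    using c sm nonneg supp by (intro that[of "\<lambda>y. (1 / c) * P0 y"] Ck_function_cmult) auto
qed

lemma has_integral_on_support:
  fixes f :: "'a::euclidean_space \<Rightarrow> 'b::banach"
  assumes "(f has_integral i) UNIV" and "\<And>x. x \<notin> S \<Longrightarrow> f x = 0"
  shows "(f has_integral i) S"
proof -
  have "(\<lambda>x. if x \<in> S then f x else 0) = f" using assms(2) by auto
  then show ?thesis using assms(1) has_integral_restrict_UNIV[of S f i] by simp
qed

lemma exists_smooth_step:
  assumes "\<delta> > 0"
  obtains \<tau> T :: "real \<Rightarrow> real" where
    "\<And>k. Ck_function k \<tau>" "\<And>s. 0 \<le> \<tau> s" "\<And>s. \<delta> \<le> \<bar>s\<bar> \<Longrightarrow> \<tau> s = 0" "(\<tau> has_integral 1) UNIV"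
    "\<And>s. (T has_real_derivative \<tau> s) (at s)" "\<And>s. s \<le> - \<delta> \<Longrightarrow> T s = 0" "\<And>s. \<delta> \<le> s \<Longrightarrow> T s = 1"
proof -
  obtain \<tau> :: "real \<Rightarrow> real" where \<tau>: "\<And>k. Ck_function k \<tau>" "\<And>s. 0 \<le> \<tau> s"
    "\<And>s. \<delta> \<le> norm s \<Longrightarrow> \<tau> s = 0" "(\<tau> has_integral 1) UNIV"
    using exists_mollifier[OF assms] by metis
  have cont: "continuous_on S \<tau>" for S
    using \<tau>(1)[of 0] continuous_on_subset by fastforce
  \<comment> \<open>Starting at -2\<delta>, strictly left of the support, covers the line by two
    cases: points up to -2\<delta> have a neighbourhood where T vanishes, and to the right of
    -2\<delta> the fundamental theorem applies.\<close>
  define T where "T = (\<lambda>s. integral {- 2 * \<delta>..s} \<tau>)"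
  have T0: "T s = 0" if "s \<le> - \<delta>" for s
  proof -
    have "T s = integral {- 2 * \<delta>..s} (\<lambda>_. 0)"
      unfolding T_def using that assms by (intro Henstock_Kurzweil_Integration.integral_cong \<tau>(3)) auto
    then show ?thesis by simp
  qed
  have T1: "T s = 1" if "\<delta> \<le> s" for s
    unfolding T_def using that assms by (intro integral_unique has_integral_on_support[OF \<tau>(4)] \<tau>(3)) auto
  have "(T has_real_derivative \<tau> s) (at s)" for s
  proof (cases "- 2 * \<delta> < s")
    case True
    then have "(T has_real_derivative \<tau> s) (at s within {- 2 * \<delta>..s + 1})"
      unfolding T_def by (intro integral_has_real_derivative cont) auto
    then show ?thesis using True by (simp add: at_within_Icc_at)
  next
    case False
    then have "\<forall>\<^sub>F y in nhds s. y < - \<delta>"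
      using eventually_nhds_in_open[of "{..<- \<delta>}" s] assms by simp
    then have "\<forall>\<^sub>F y in nhds s. 0 = T y"
      by eventually_elim (simp add: T0)
    moreover have "((\<lambda>_. 0) has_real_derivative \<tau> s) (at s)"
      using False assms \<tau>(3)[of s] by simp
    ultimately show ?thesis using DERIV_cong_ev[OF refl _ refl, of "\<lambda>_. 0" T s] by blast
  qed
  then show ?thesis using that[of \<tau> T] \<tau> T0 T1 by simp
qed

text \<open>\<open>K\<close> is the indicator of [0, h] divided by h and smoothed by
  \<open>\<tau>\<close>. Building it from the primitive of \<open>\<tau>\<close> makes its
  derivative a difference of two copies of \<open>\<tau>\<close> at distance h, which is how the
  derivative of an average becomes a difference quotient.\<close>

lemma exists_time_kernel:
  fixes \<delta> h :: real
  assumes "\<delta> > 0" "h > 0"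
  obtains \<tau> K :: "real \<Rightarrow> real" where
    "\<And>k. Ck_function k \<tau>" "\<And>s. 0 \<le> \<tau> s" "\<And>s. \<delta> \<le> \<bar>s\<bar> \<Longrightarrow> \<tau> s = 0" "(\<tau> has_integral 1) UNIV"
    "\<And>k. Ck_function k K" "\<And>s. 0 \<le> K s" "\<And>s. s \<le> - \<delta> \<or> h + \<delta> \<le> s \<Longrightarrow> K s = 0"
    "\<And>a b. a \<le> - \<delta> \<Longrightarrow> h + \<delta> \<le> b \<Longrightarrow> integral {a..b} K = 1"
    "\<And>s. (K has_real_derivative (\<tau> s - \<tau> (s - h)) / h) (at s)"
proof -
  obtain \<tau> T where \<tau>: "\<And>k. Ck_function k \<tau>" "\<And>s. 0 \<le> \<tau> s" "\<And>s. \<delta> \<le> \<bar>s\<bar> \<Longrightarrow> \<tau> s = 0" "(\<tau> has_integral 1) UNIV"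
    and T: "\<And>s. (T has_real_derivative \<tau> s) (at s)" "\<And>s. s \<le> - \<delta> \<Longrightarrow> T s = 0" "\<And>s. \<delta> \<le> s \<Longrightarrow> T s = 1"
    using exists_smooth_step[OF assms(1)] by blast
  define K where "K = (\<lambda>s. (1 / h) * (T s + (- 1) * T (s - h)))"
  have mono: "T s \<le> T s'" if "s \<le> s'" for s s'
    using DERIV_nonneg_imp_nondecreasing[OF that] T(1) \<tau>(2) by blast
  have smT: "Ck_function k T" for k
    by (cases k) (use T(1) in \<open>auto intro!: continuous_at_imp_continuous_on DERIV_isCont Ck_function_real_SucI \<tau>
      simp del: Ck_function.simps(2)\<close>)
  have contT: "continuous_on S T" for S
    using smT[of 0] continuous_on_subset by fastforce
  have dK: "(K has_real_derivative (\<tau> s - \<tau> (s - h)) / h) (at s)" for s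
    unfolding K_def
    using assms by (auto intro!: derivative_eq_intros T(1) DERIV_chain'[OF _ T(1)] simp: field_simps)
  have "integral {a..b} K = 1" if "a \<le> - \<delta>" "h + \<delta> \<le> b" for a b
  proof -
    have int: "T integrable_on {c..d}" for c d
      by (intro integrable_continuous_interval contT)
    have a: "a \<le> b - h" using that assms by linarith
    have sh: "((\<lambda>s. T (s - h)) has_integral integral {a - h..b - h} T) {a..b}"
      using has_integral_shift_Icc_real[of T "- h" "integral {a - h..b - h} T" a b]
        integrable_integral[OF int[of "a - h" "b - h"]] by (simp add: o_def)
    \<comment> \<open>The integrals over the common interval [a, b - h] cancel. Only the end pieces
      of length h remain, where T is 0 and 1, so the difference is exactly h.\<close>
    have "integral {a - h..b - h} T = integral {a - h..a} T + integral {a..b - h} T"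
      by (rule Henstock_Kurzweil_Integration.integral_combine[symmetric]) (use a assms int in auto)
    moreover have "integral {a..b} T = integral {a..b - h} T + integral {b - h..b} T"
      by (rule Henstock_Kurzweil_Integration.integral_combine[symmetric]) (use a assms int in auto)
    moreover have "integral {a - h..a} T = integral {a - h..a} (\<lambda>_. 0)"
      using that by (intro Henstock_Kurzweil_Integration.integral_cong) (simp add: T(2))
    moreover have "integral {b - h..b} T = integral {b - h..b} (\<lambda>_. 1)"
      using that by (intro Henstock_Kurzweil_Integration.integral_cong) (simp add: T(3))
    ultimately have "integral {a..b} T - integral {a - h..b - h} T = h" using assms by simp
    moreover have "(K has_integral (1 / h) * (integral {a..b} T + (- 1) * integral {a - h..b - h} T)) {a..b}"
      unfolding K_def by (intro has_integral_mult_right has_integral_add integrable_integral int sh)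
    ultimately show ?thesis using assms by (simp add: integral_unique)
  qed
  moreover have "Ck_function k K" for k
    unfolding K_def by (rule Ck_function_cmult[OF Ck_function_add[OF smT Ck_function_cmult[OF Ck_function_shift[OF smT]]]])
  moreover have "0 \<le> K s" for s using mono[of "s - h" s] assms by (simp add: K_def)
  moreover have "K s = 0" if "s \<le> - \<delta> \<or> h + \<delta> \<le> s" for s
    using that assms T(2)[of s] T(2)[of "s - h"] T(3)[of s] T(3)[of "s - h"] by (auto simp: K_def)
  ultimately show ?thesis using that[of \<tau> K] \<tau> dK by blast
qed

section \<open>The equation tested with product functions\<close>

text \<open>The weak formulation uses Lebesgue integrals, whereas differentiation under the integral
  sign and iterated integration are applied to gauge integrals over boxes. Continuous integrands
  supported in a box pass from one to the other.\<close>

lemma integral_eq_cbox_integral: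
  fixes g :: "'a::euclidean_space \<Rightarrow> 'b::euclidean_space"
  assumes "continuous_on (cbox a b) g" and "\<And>z. z \<notin> cbox a b \<Longrightarrow> g z = 0"
  shows "integrable lborel g" and "integral\<^sup>L lborel g = integral (cbox a b) g"
proof -
  have "(\<lambda>z. indicator (cbox a b) z *\<^sub>R g z) = g"
    using assms(2) by (auto simp: indicator_def)
  then show g: "integrable lborel g"
    using borel_integrable_compact[OF compact_cbox assms(1)] by simp
  show "integral\<^sup>L lborel g = integral (cbox a b) g"
    using has_integral_on_support[OF has_integral_integral_lborel[OF g], of "cbox a b"] assms(2)
    by (metis integral_unique)
qed

lemma test_function_prod:
  fixes P :: "'a::euclidean_space \<Rightarrow> real" and Q :: "'b::euclidean_space \<Rightarrow> real"
  assumes "\<And>k. Ck_function k P" "\<And>k. Ck_function k Q" "compact A" "compact B" "A \<times> B \<subseteq> S"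
    and "\<And>y. y \<notin> A \<Longrightarrow> P y = 0" "\<And>s. s \<notin> B \<Longrightarrow> Q s = 0"
  shows "test_function S (\<lambda>z. P (fst z) * Q (snd z))"
proof -
  have AB: "compact (A \<times> B)" using assms by (simp add: compact_Times)
  have cl: "closure {z. P (fst z) * Q (snd z) \<noteq> 0} \<subseteq> A \<times> B"
    by (rule closure_minimal) (use assms(6,7) in \<open>force simp: compact_imp_closed[OF AB]\<close>)+
  have "compact (closure {z. P (fst z) * Q (snd z) \<noteq> 0})"
    using closed_Int_compact[OF closed_closure AB, of "{z. P (fst z) * Q (snd z) \<noteq> 0}"]
    by (simp only: Int_absorb2[OF cl])
  with cl show ?thesis
    using assms by (auto simp: test_function_def intro!: Ck_function_mult Ck_function_fst Ck_function_snd)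
qed

abbreviation pderivative :: "'n \<Rightarrow> (real^'n \<Rightarrow> real) \<Rightarrow> real^'n \<Rightarrow> real" where
  "pderivative i P y \<equiv> frechet_derivative P (at y) (axis i 1)"

lemma Ck_function_pderivative: "(\<And>k. Ck_function k P) \<Longrightarrow> Ck_function k (pderivative i P)"
  using Ck_function_Suc_derivative(2)[of k P "axis i 1"] by blast

lemma pderivative_support:
  assumes "closed A" and "\<And>y. y \<notin> A \<Longrightarrow> P y = 0" and "y \<notin> A"
  shows "pderivative i P y = 0"
proof -
  have "(P has_derivative (\<lambda>_. 0)) (at y)"
    by (rule has_derivative_transform_within_open[of "\<lambda>_. 0" _ _ _ "- A"]) (use assms in \<open>auto simp: open_Compl\<close>)
  then show ?thesis using frechet_derivative_at by metis
qed

lemma frechet_derivative_prod: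
  fixes P :: "'a::euclidean_space \<Rightarrow> real"
  assumes "Ck_function 1 P" and "(Q has_real_derivative Q' (snd z)) (at (snd z))"
  shows "frechet_derivative (\<lambda>z. P (fst z) * Q (snd z)) (at z) =
     (\<lambda>v. frechet_derivative P (at (fst z)) (fst v) * Q (snd z) + P (fst z) * (Q' (snd z) * snd v))"
proof (rule frechet_derivative_at[symmetric])
  have 1: "(fst has_derivative fst) (at z)" and 2: "(snd has_derivative snd) (at z)"
    by (auto intro!: derivative_eq_intros)
  have "((\<lambda>z. P (fst z)) has_derivative (\<lambda>v. frechet_derivative P (at (fst z)) (fst v))) (at z)"
    using diff_chain_at[OF 1 Ck_function_Suc_derivative(1)[of 0 P]] assms(1) by (simp add: o_def)
  moreover have "((\<lambda>z. Q (snd z)) has_derivative (\<lambda>v. Q' (snd z) * snd v)) (at z)"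
    using diff_chain_at[OF 2 assms(2)[unfolded has_field_derivative_def]] by (simp add: o_def)
  ultimately show "((\<lambda>z. P (fst z) * Q (snd z)) has_derivative
     (\<lambda>v. frechet_derivative P (at (fst z)) (fst v) * Q (snd z) + P (fst z) * (Q' (snd z) * snd v))) (at z)"
    by (rule has_derivative_eq_rhs[OF has_derivative_mult]) (auto simp: algebra_simps)
qed

text \<open>On a box, square integrability gives integrability through r \<le> 1 + r^2. This allows
  the integrals that pair the weak gradient with test functions to be split.\<close>

lemma integrable_mult_square_integrable:
  fixes V :: "'a::euclidean_space \<Rightarrow> 'b::euclidean_space"
  assumes V: "V \<in> borel_measurable borel" "set_integrable lborel (cbox a b) (\<lambda>z. (norm (V z))\<^sup>2)"
    and g: "continuous_on UNIV g" "\<And>z. z \<notin> cbox a b \<Longrightarrow> g z = 0"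
  shows "integrable lborel (\<lambda>z. g z *\<^sub>R V z)"
proof -
  have cg: "continuous_on S g" for S using g(1) continuous_on_subset by blast
  have "compact (g ` cbox a b)" by (intro compact_continuous_image cg compact_cbox)
  then obtain C where C: "C > 0" "\<And>z. z \<in> cbox a b \<Longrightarrow> \<bar>g z\<bar> \<le> C"
    using compact_imp_bounded bounded_pos by (metis imageI real_norm_def)
  have "integrable lborel (\<lambda>z. C * (indicator (cbox a b) z *\<^sub>R (1::real) + indicator (cbox a b) z *\<^sub>R (norm (V z))\<^sup>2))"
    using V(2) unfolding set_integrable_def
    by (intro integrable_mult_right Bochner_Integration.integrable_add
        borel_integrable_compact[OF compact_cbox continuous_on_const])
  then show ?thesis
  proof (rule Bochner_Integration.integrable_bound)
    have [measurable]: "g \<in> borel_measurable borel" using g(1) by (rule borel_measurable_continuous_onI)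
    have [measurable]: "V \<in> borel_measurable borel" by (rule V)
    show "(\<lambda>z. g z *\<^sub>R V z) \<in> borel_measurable lborel" by measurable
    have "norm (g z *\<^sub>R V z) \<le> C * (1 + (norm (V z))\<^sup>2)" if "z \<in> cbox a b" for z
    proof -
      have "r \<le> 1 + r\<^sup>2" for r :: real
      proof -
        have "2 * r \<le> r\<^sup>2 + 1" using zero_le_power2[of "r - 1"] unfolding power2_diff by simp
        moreover have "0 \<le> r\<^sup>2" by simp
        ultimately show ?thesis by linarith
      qed
      from this[of "norm (V z)"] have "norm (V z) \<le> 1 + (norm (V z))\<^sup>2" .
      then show ?thesis using C that by (auto intro!: mult_mono)
    qed
    then show "AE z in lborel. norm (g z *\<^sub>R V z) \<le>
      norm (C * (indicator (cbox a b) z *\<^sub>R (1::real) + indicator (cbox a b) z *\<^sub>R (norm (V z))\<^sup>2))"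
      using C g(2) by (intro AE_I2) (auto simp: indicator_def)
  qed
qed

text \<open>Freezing \<open>u\<close> at its initial value for negative times makes it continuous everywhere; the
  test functions in use vanish there.\<close>

definition time_extension :: "(real^'n \<Rightarrow> real \<Rightarrow> real) \<Rightarrow> (real^'n) \<times> real \<Rightarrow> real" where
  "time_extension u z = u (fst z) (max 0 (snd z))"

lemma time_extension_eq [simp]: "0 \<le> t \<Longrightarrow> time_extension u (x, t) = u x t"
  by (simp add: time_extension_def)

lemma
  assumes "global_weak_solution m p L u0 u"
  shows continuous_time_extension: "continuous_on S (time_extension u)"
    and time_extension_nonneg: "0 \<le> time_extension u z"
proof -
  have "continuous_on UNIV (\<lambda>z. (\<lambda>(x, t). u x t) (fst z, max 0 (snd z)))"
    by (rule continuous_on_compose2[of "UNIV \<times> {0..}"])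
       (use assms in \<open>auto simp: global_weak_solution_def intro!: continuous_intros\<close>)
  then have "continuous_on UNIV (time_extension u)"
    by (simp add: time_extension_def[abs_def])
  then show "continuous_on S (time_extension u)" using continuous_on_subset by blast
  show "0 \<le> time_extension u z" using assms by (simp add: global_weak_solution_def time_extension_def)
qed

lemma continuous_time_extension_powr:
  assumes "global_weak_solution m p L u0 u" and "0 < q"
  shows "continuous_on S (\<lambda>z. time_extension u z powr q)"
  using assms continuous_time_extension[OF assms(1)] time_extension_nonneg[OF assms(1)]
  by (intro continuous_on_powr') (auto intro!: continuous_intros)

text \<open>Testing with a product leaves the unknown gradient V paired with the gradient of P.
  Using the definition of V once more, with the derivatives of P as test functions in space, puts a
  second derivative on P and eliminates V. The reaction stays a Lebesgue integral because the
  indicator of the ball is discontinuous.\<close>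

lemma weak_identity:
  fixes P :: "real^'n \<Rightarrow> real" and Q Q' :: "real \<Rightarrow> real"
  assumes sol: "global_weak_solution m p L u0 u" and mp: "0 < m" "0 < p"
    and P: "\<And>k. Ck_function k P" "\<And>y. y \<notin> cbox c d \<Longrightarrow> P y = 0"
    and Q: "\<And>k. Ck_function k Q" "\<And>s. (Q has_real_derivative Q' s) (at s)" "continuous_on UNIV Q'"
      "\<And>s. s \<notin> {a..b} \<Longrightarrow> Q s = 0" "\<And>s. s \<notin> {a..b} \<Longrightarrow> Q' s = 0" "0 < a"
  shows "integrable lborel (\<lambda>z. indicator (ball 0 L) (fst z) * time_extension u z powr p * (P (fst z) * Q (snd z)))"
    and "integral (cbox (c, a) (d, b)) (\<lambda>z. time_extension u z * (P (fst z) * Q' (snd z)))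
      + (\<Sum>i\<in>UNIV. integral (cbox (c, a) (d, b))
          (\<lambda>z. time_extension u z powr m * (pderivative i (pderivative i P) (fst z) * Q (snd z))))
      + (LINT z|lborel. indicator (ball 0 L) (fst z) * time_extension u z powr p * (P (fst z) * Q (snd z))) = 0"
proof -
  let ?S = "UNIV \<times> {0<..} :: ((real^'n) \<times> real) set"
  let ?C = "cbox (c, a) (d, b)"
  obtain V where V: "weak_space_grad (\<lambda>(x, t). u x t powr m) V"
    and weak: "\<And>\<phi>. test_function UNIV \<phi> \<Longrightarrow>
           set_lebesgue_integral lborel ?S
             (\<lambda>(x, t). u x t * time_deriv \<phi> (x, t) - V (x, t) \<bullet> space_grad \<phi> (x, t)
                       + indicator (ball 0 L) x * u x t powr p * \<phi> (x, t))
           + (LINT x|lborel. u0 x * \<phi> (x, 0)) = 0"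
    using sol unfolding global_weak_solution_def by auto
  define g1 where "g1 = (\<lambda>z. time_extension u z * (P (fst z) * Q' (snd z)))"
  define g2 where "g2 = (\<lambda>i j z. time_extension u z powr m * (pderivative j (pderivative i P) (fst z) * Q (snd z)))"
  define g3 where "g3 = (\<lambda>i z. (pderivative i P (fst z) * Q (snd z)) *\<^sub>R V z)"
  define g4 where "g4 = (\<lambda>z. time_extension u z powr p * (P (fst z) * Q (snd z)))"
  define g5 where "g5 = (\<lambda>z. indicator (ball 0 L) (fst z) * time_extension u z powr p * (P (fst z) * Q (snd z)))"
  note P1 = Ck_function_pderivative[OF P(1)]
  note P2 = Ck_function_pderivative[OF P1]
  have P1s: "pderivative i P y = 0" if "y \<notin> cbox c d" for i y
    using that by (intro pderivative_support[OF closed_cbox P(2)])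
  have P2s: "pderivative j (pderivative i P) y = 0" if "y \<notin> cbox c d" for i j y
    using that by (intro pderivative_support[OF closed_cbox P1s])
  have cP: "continuous_on A (\<lambda>z. f (fst z))" if "\<And>k. Ck_function k f" for f :: "real^'n \<Rightarrow> real" and A :: "((real^'n) \<times> real) set"
    using that[of 0] by (auto intro!: continuous_on_compose2[of UNIV f] continuous_intros)
  have cQ: "continuous_on A (\<lambda>z. f (snd z))" if "continuous_on UNIV f" for f :: "real \<Rightarrow> real" and A :: "((real^'n) \<times> real) set"
    using that by (auto intro!: continuous_on_compose2[of UNIV f] continuous_intros)
  note cont = continuous_on_mult continuous_time_extension[OF sol] continuous_time_extension_powr[OF sol mp(1)]
    continuous_time_extension_powr[OF sol mp(2)] cP[OF P(1)] cP[OF P1] cP[OF P2] cQ[OF Q(3)]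
    cQ[OF Ck_function_imp_continuous[OF Q(1)]]
  have C: "z \<in> ?C \<longleftrightarrow> fst z \<in> cbox c d \<and> snd z \<in> {a..b}" for z
    by (cases z) auto
  have i1: "integrable lborel g1" "integral\<^sup>L lborel g1 = integral ?C g1"
    by (rule integral_eq_cbox_integral; use P(2) Q(5) C in \<open>force simp: g1_def intro!: cont\<close>)+
  have i2: "integrable lborel (g2 i j)" "integral\<^sup>L lborel (g2 i j) = integral ?C (g2 i j)" for i j
    by (rule integral_eq_cbox_integral; use P2s Q(4) C in \<open>force simp: g2_def intro!: cont\<close>)+
  have i4: "integrable lborel g4"
    by (rule integral_eq_cbox_integral; use P(2) Q(4) C in \<open>force simp: g4_def intro!: cont\<close>)
  have "ball 0 L \<times> (UNIV :: real set) \<in> sets lborel"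
    by (simp add: borel_open open_Times)
  from integrable_mult_indicator[OF this i4] show i5: "integrable lborel g5"
    by (rule Bochner_Integration.integrable_cong[THEN iffD1, OF refl, rotated]) (auto simp: g4_def g5_def indicator_def)
  have "?C \<subseteq> UNIV \<times> {0..}" using C Q(6) by force
  then have i3: "integrable lborel (g3 i)" for i
    unfolding g3_def using V C P1s Q(4)
    by (intro integrable_mult_square_integrable[of _ "(c, a)" "(d, b)"] cont) (auto simp: weak_space_grad_def)
  have grad: "space_grad (\<lambda>z. f (fst z) * Q (snd z)) z = (\<chi> i. pderivative i f (fst z) * Q (snd z))"
    if "\<And>k. Ck_function k f" for f z
    unfolding space_grad_def by (subst frechet_derivative_prod[where Q' = Q']) (use that Q in auto)
  have time: "time_deriv (\<lambda>z. P (fst z) * Q (snd z)) z = P (fst z) * Q' (snd z)" for z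
    unfolding time_deriv_def
    using linear_0[OF has_derivative_linear[OF Ck_function_Suc_derivative(1)[OF P(1)]]]
    by (subst frechet_derivative_prod[where Q' = Q']) (use P Q in auto)
  \<comment> \<open>The weak gradient identity is vector valued; with the i-th derivative of P in
    the test function, its i-th component carries the pure second derivative.\<close>
  have e3: "integral\<^sup>L lborel (g2 i i) = - (integral\<^sup>L lborel (g3 i) $ i)" for i
  proof -
    have "test_function ?S (\<lambda>z. pderivative i P (fst z) * Q (snd z))"
      by (rule test_function_prod[OF P1 Q(1) compact_cbox compact_Icc _ P1s Q(4)]) (use Q(6) in auto)
    then have "set_lebesgue_integral lborel ?S (\<lambda>z. (case z of (x, t) \<Rightarrow> u x t powr m) *\<^sub>R
           space_grad (\<lambda>z. pderivative i P (fst z) * Q (snd z)) z)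
         = - set_lebesgue_integral lborel ?S (g3 i)"
      using V by (simp add: weak_space_grad_def g3_def)
    moreover have "set_lebesgue_integral lborel ?S (g3 i) = integral\<^sup>L lborel (g3 i)"
      unfolding set_lebesgue_integral_def using Q(4,6)
      by (intro Bochner_Integration.integral_cong refl) (force simp: g3_def indicator_def)
    moreover have "set_lebesgue_integral lborel ?S (\<lambda>z. (case z of (x, t) \<Rightarrow> u x t powr m) *\<^sub>R
           space_grad (\<lambda>z. pderivative i P (fst z) * Q (snd z)) z) = (LINT z|lborel. (\<chi> j. g2 i j z))"
      unfolding set_lebesgue_integral_def grad[OF P1] using Q(4,6)
      by (intro Bochner_Integration.integral_cong refl)
         (force simp: g2_def indicator_def vec_eq_iff time_extension_def)
    ultimately have eq: "(LINT z|lborel. (\<chi> j. g2 i j z)) = - integral\<^sup>L lborel (g3 i)" by simp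
    have "integrable lborel (\<lambda>z. (\<chi> j. g2 i j z))"
      by (rule integral_eq_cbox_integral[of "(c, a)" "(d, b)"])
         (use P2s Q(4) C in \<open>force simp: g2_def vec_eq_iff intro!: cont continuous_on_vec_lambda\<close>)+
    from integral_bounded_linear[OF bounded_linear_vec_nth this, of i] eq show ?thesis by simp
  qed
  have e3': "integral\<^sup>L lborel (g3 i) $ i = (LINT z|lborel. g3 i z $ i)" for i
    using integral_bounded_linear[OF bounded_linear_vec_nth i3, of i] by simp
  have i3': "integrable lborel (\<lambda>z. g3 i z $ i)" for i
    by (rule integrable_bounded_linear[OF bounded_linear_vec_nth i3])
  have "test_function UNIV (\<lambda>z. P (fst z) * Q (snd z))"
    by (rule test_function_prod[OF P(1) Q(1) compact_cbox compact_Icc _ P(2) Q(4)]) auto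
  note weak[OF this]
  \<comment> \<open>The support of Q lies in positive times, so the integral with the initial datum
    drops out.\<close>
  moreover have "Q 0 = 0" using Q(4,6) by simp
  moreover have "set_lebesgue_integral lborel ?S
     (\<lambda>(x, t). u x t * time_deriv (\<lambda>z. P (fst z) * Q (snd z)) (x, t)
        - V (x, t) \<bullet> space_grad (\<lambda>z. P (fst z) * Q (snd z)) (x, t)
        + indicator (ball 0 L) x * u x t powr p * (P (fst (x, t)) * Q (snd (x, t))))
     = (LINT z|lborel. g1 z - (\<Sum>i\<in>UNIV. g3 i z $ i) + g5 z)"
    unfolding set_lebesgue_integral_def grad[OF P(1)] time using Q(4,5,6)
    by (intro Bochner_Integration.integral_cong refl)
       (force simp: g1_def g3_def g5_def indicator_def inner_vec_def time_extension_def mult_ac)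
  ultimately have "(LINT z|lborel. g1 z - (\<Sum>i\<in>UNIV. g3 i z $ i) + g5 z) = 0" by simp
  moreover have "(LINT z|lborel. g1 z - (\<Sum>i\<in>UNIV. g3 i z $ i) + g5 z)
     = integral\<^sup>L lborel g1 - (\<Sum>i\<in>UNIV. LINT z|lborel. g3 i z $ i) + integral\<^sup>L lborel g5"
    using i1 i3' i5 by simp
  ultimately show "integral ?C g1 + (\<Sum>i\<in>UNIV. integral ?C (g2 i i)) + integral\<^sup>L lborel g5 = 0"
    using e3 e3' i1(2) i2(2) by (simp add: sum_negf)
qed

section \<open>Approximation by mollified time averages\<close>

text \<open>A correlation, not a convolution: the kernel sits at z - (x, t), so a kernel on [0, h]
  looks forward in time, and each derivative in x or t brings a minus sign. The box stays fixed
  while (x, t) moves, so for smooth kernels all derivatives exist everywhere, even where the kernel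
  sticks out of the box.\<close>

definition kernel_avg ::
  "((real^'n) \<times> real) set \<Rightarrow> ((real^'n) \<times> real \<Rightarrow> real) \<Rightarrow> (real^'n \<Rightarrow> real) \<Rightarrow> (real \<Rightarrow> real)
    \<Rightarrow> real^'n \<Rightarrow> real \<Rightarrow> real" where
  "kernel_avg C v P K x t = integral C (\<lambda>z. v z * (P (fst z - x) * K (snd z - t)))"

lemma continuous_kernel:
  fixes P :: "'a::euclidean_space \<Rightarrow> real" and K :: "real \<Rightarrow> real"
  assumes "continuous_on UNIV P" "continuous_on UNIV K"
    and "continuous_on S f" "continuous_on S g"
  shows "continuous_on S (\<lambda>z. P (f z) * K (g z))"
  using assms by (auto intro!: continuous_intros intro: continuous_on_compose2[of UNIV P] continuous_on_compose2[of UNIV K])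

lemma kernel_avg_time_derivative:
  fixes P :: "real^'n \<Rightarrow> real"
  assumes v: "continuous_on UNIV v" and P: "continuous_on UNIV P"
    and K: "\<And>s. (K has_real_derivative K' s) (at s)" "continuous_on UNIV K'"
  shows "((\<lambda>t. kernel_avg (cbox c d) v P K x t) has_real_derivative - kernel_avg (cbox c d) v P K' x t) (at t)"
proof -
  have vC: "continuous_on A v" for A using v continuous_on_subset by blast
  have cK: "continuous_on UNIV K" using K(1) DERIV_isCont by (blast intro: continuous_at_imp_continuous_on)
  have "((\<lambda>t. integral (cbox c d) (\<lambda>z. v z * (P (fst z - x) * K (snd z - t)))) has_real_derivative
      integral (cbox c d) (\<lambda>z. - (v z * (P (fst z - x) * K' (snd z - t))))) (at t within UNIV)"
  proof (rule leibniz_rule_field_derivative)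
    show "((\<lambda>t. v z * (P (fst z - x) * K (snd z - t))) has_real_derivative
        - (v z * (P (fst z - x) * K' (snd z - t)))) (at t within UNIV)" for t z
      by (auto intro!: derivative_eq_intros DERIV_chain'[OF _ K(1)])
    show "(\<lambda>z. v z * (P (fst z - x) * K (snd z - t))) integrable_on cbox c d" for t
      by (intro integrable_continuous continuous_on_mult vC continuous_kernel P cK continuous_intros)
    show "continuous_on (UNIV \<times> cbox c d) (\<lambda>(t, z). - (v z * (P (fst z - x) * K' (snd z - t))))"
      unfolding case_prod_beta
      by (intro continuous_on_minus continuous_on_mult continuous_kernel P K continuous_intros
          continuous_on_compose2[OF v]) auto
  qed auto
  then show ?thesis by (simp add: kernel_avg_def integral_neg)
qed

lemma kernel_avg_space_derivative:
  fixes P :: "real^'n \<Rightarrow> real"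
  assumes v: "continuous_on UNIV v" and P: "\<And>k. Ck_function k P" and K: "continuous_on UNIV K"
  shows "((\<lambda>r. kernel_avg (cbox c d) v P K (x + r *\<^sub>R axis i 1) t) has_real_derivative
      - kernel_avg (cbox c d) v (pderivative i P) K x t) (at 0)"
proof -
  have vC: "continuous_on A v" for A using v continuous_on_subset by blast
  note cP = Ck_function_imp_continuous[OF P] Ck_function_imp_continuous[OF Ck_function_pderivative[OF P]]
  have "((\<lambda>r. integral (cbox c d) (\<lambda>z. v z * (P (fst z - (x + r *\<^sub>R axis i 1)) * K (snd z - t)))) has_real_derivative
      integral (cbox c d) (\<lambda>z. - (v z * (pderivative i P (fst z - (x + 0 *\<^sub>R axis i 1)) * K (snd z - t))))) (at 0 within UNIV)"
  proof (rule leibniz_rule_field_derivative)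
    show "((\<lambda>r. v z * (P (fst z - (x + r *\<^sub>R axis i 1)) * K (snd z - t))) has_real_derivative
        - (v z * (pderivative i P (fst z - (x + r *\<^sub>R axis i 1)) * K (snd z - t)))) (at r within UNIV)" for r z
    proof -
      let ?D = "frechet_derivative P (at (fst z - (x + r *\<^sub>R axis i 1)))"
      have "((\<lambda>r. fst z - (x + r *\<^sub>R axis i 1)) has_derivative (\<lambda>q. - (q *\<^sub>R axis i 1))) (at r)"
        by (auto intro!: derivative_eq_intros)
      from diff_chain_at[OF this Ck_function_Suc_derivative(1)[OF P]]
      have "((\<lambda>r. P (fst z - (x + r *\<^sub>R axis i 1))) has_derivative (\<lambda>q. ?D (- (q *\<^sub>R axis i 1)))) (at r)"
        by (simp add: o_def)
      moreover
      have lin: "linear ?D"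
        by (rule has_derivative_linear[OF Ck_function_Suc_derivative(1)[OF P]])
      have "(\<lambda>q. ?D (- (q *\<^sub>R axis i 1))) = (*) (- ?D (axis i 1))"
        using linear_neg[OF lin] linear_scale[OF lin] by (simp add: mult.commute fun_eq_iff)
      ultimately have "((\<lambda>r. P (fst z - (x + r *\<^sub>R axis i 1))) has_real_derivative - ?D (axis i 1)) (at r)"
        by (simp add: has_field_derivative_def)
      then show ?thesis by (auto intro!: derivative_eq_intros)
    qed
    show "(\<lambda>z. v z * (P (fst z - (x + r *\<^sub>R axis i 1)) * K (snd z - t))) integrable_on cbox c d" for r
      by (intro integrable_continuous continuous_on_mult vC continuous_kernel cP K continuous_intros)
    show "continuous_on (UNIV \<times> cbox c d)
       (\<lambda>(r, z). - (v z * (pderivative i P (fst z - (x + r *\<^sub>R axis i 1)) * K (snd z - t))))"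
      unfolding case_prod_beta
      by (intro continuous_on_minus continuous_on_mult continuous_kernel cP K continuous_intros
          continuous_on_compose2[OF v]) auto
  qed auto
  then show ?thesis by (simp add: kernel_avg_def integral_neg)
qed

lemma continuous_kernel_avg:
  fixes P :: "real^'n \<Rightarrow> real"
  assumes v: "continuous_on UNIV v" and P: "continuous_on UNIV P" and K: "continuous_on UNIV K"
  shows "continuous_on UNIV (\<lambda>z. kernel_avg (cbox c d) v P K (fst z) (snd z))"
  unfolding kernel_avg_def
proof (rule integral_continuous_on_param)
  show "continuous_on (UNIV \<times> cbox c d) (\<lambda>(y, z). v z * (P (fst z - fst y) * K (snd z - snd y)))"
    unfolding case_prod_beta
    by (intro continuous_on_mult continuous_kernel P K continuous_intros continuous_on_compose2[OF v]) auto
qed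

text \<open>The sign is opposite to that of a forward difference; it cancels the minus sign in
  \<open>kernel_avg_time_derivative\<close>.\<close>

lemma kernel_avg_time_difference:
  fixes P :: "real^'n \<Rightarrow> real"
  assumes v: "continuous_on UNIV v" and P: "continuous_on UNIV P" and \<tau>: "continuous_on UNIV \<tau>"
  shows "kernel_avg (cbox c d) v P (\<lambda>s. (\<tau> s - \<tau> (s - h)) / h) x t
    = (kernel_avg (cbox c d) v P \<tau> x t - kernel_avg (cbox c d) v P \<tau> x (t + h)) / h"
proof -
  have vC: "continuous_on A v" for A using v continuous_on_subset by blast
  have i: "(\<lambda>z. v z * (P (fst z - x) * \<tau> (snd z - t))) integrable_on cbox c d" for t
    by (intro integrable_continuous continuous_on_mult vC continuous_kernel P \<tau> continuous_intros)
  have "kernel_avg (cbox c d) v P (\<lambda>s. (\<tau> s - \<tau> (s - h)) / h) x t =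
    integral (cbox c d) (\<lambda>z. (v z * (P (fst z - x) * \<tau> (snd z - t))
        - v z * (P (fst z - x) * \<tau> (snd z - (t + h)))) / h)"
    unfolding kernel_avg_def
    by (intro Henstock_Kurzweil_Integration.integral_cong) (simp add: field_simps diff_diff_eq)
  then show ?thesis
    by (simp add: kernel_avg_def integral_divide Henstock_Kurzweil_Integration.integral_diff[OF i i])
qed

lemma kernel_mass:
  fixes P :: "real^'n \<Rightarrow> real" and K :: "real \<Rightarrow> real"
  assumes P: "continuous_on UNIV P" and K: "continuous_on UNIV K"
    and "integral (cbox c d) (\<lambda>y. P (y - x)) = 1" and "integral {a..b} (\<lambda>s. K (s - t)) = 1"
  shows "integral (cbox (c, a) (d, b)) (\<lambda>z. P (fst z - x) * K (snd z - t)) = 1"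
proof -
  have "continuous_on (cbox (c, a) (d, b)) (\<lambda>z. P (fst z - x) * K (snd z - t))"
    by (rule continuous_kernel[OF P K]) (intro continuous_intros)+
  from integral_prod_continuous[OF this]
  have "integral (cbox (c, a) (d, b)) (\<lambda>z. P (fst z - x) * K (snd z - t)) =
    integral (cbox c d) (\<lambda>y. integral (cbox a b) (\<lambda>s. P (y - x) * K (s - t)))"
    by simp
  then show ?thesis using assms(3,4) by simp
qed

lemma kernel_avg_close:
  fixes P :: "real^'n \<Rightarrow> real"
  assumes v: "continuous_on UNIV v" and P: "continuous_on UNIV P" "\<And>y. 0 \<le> P y"
    and K: "continuous_on UNIV K" "\<And>s. 0 \<le> K s"
    and mass: "integral (cbox c d) (\<lambda>z. P (fst z - x) * K (snd z - t)) = 1"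
    and close: "\<And>y s. P (y - x) \<noteq> 0 \<Longrightarrow> K (s - t) \<noteq> 0 \<Longrightarrow> \<bar>v (y, s) - v0\<bar> \<le> e"
  shows "\<bar>kernel_avg (cbox c d) v P K x t - v0\<bar> \<le> e"
proof -
  let ?k = "\<lambda>z. P (fst z - x) * K (snd z - t)"
  have vC: "continuous_on A v" for A using v continuous_on_subset by blast
  have ik: "?k integrable_on cbox c d"
    by (intro integrable_continuous continuous_kernel P K continuous_intros)
  have iv: "(\<lambda>z. v z * ?k z) integrable_on cbox c d"
    by (intro integrable_continuous continuous_on_mult vC continuous_kernel P K continuous_intros)
  have "(v0 - e) * ?k z \<le> v z * ?k z \<and> v z * ?k z \<le> (v0 + e) * ?k z" for z
  proof (cases "?k z = 0")
    case False
    then have "\<bar>v z - v0\<bar> \<le> e" using close[of "fst z" "snd z"] by auto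
    then show ?thesis using P(2) K(2) by (intro conjI mult_right_mono) auto
  qed auto
  then have "integral (cbox c d) (\<lambda>z. (v0 - e) * ?k z) \<le> integral (cbox c d) (\<lambda>z. v z * ?k z)"
    "integral (cbox c d) (\<lambda>z. v z * ?k z) \<le> integral (cbox c d) (\<lambda>z. (v0 + e) * ?k z)"
    by (intro integral_le iv integrable_on_mult_right ik; blast)+
  then show ?thesis by (simp add: kernel_avg_def mass abs_le_iff)
qed

lemma uniform_continuity_slab:
  fixes v :: "('a::euclidean_space) \<times> real \<Rightarrow> real"
  assumes "continuous_on UNIV v" "e > 0"
  obtains \<eta> where "\<eta> > 0"
    "\<And>x y s t. norm x \<le> R \<Longrightarrow> norm y \<le> R \<Longrightarrow> 0 \<le> s \<Longrightarrow> s \<le> T \<Longrightarrow> 0 \<le> t \<Longrightarrow> t \<le> T \<Longrightarrow>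
       norm (y - x) < \<eta> \<Longrightarrow> \<bar>s - t\<bar> < \<eta> \<Longrightarrow> \<bar>v (y, s) - v (x, t)\<bar> \<le> e"
proof -
  have "uniformly_continuous_on (cball 0 R \<times> {0..T}) v"
    using assms(1) by (intro compact_uniformly_continuous compact_Times) (auto intro: continuous_on_subset)
  then obtain d where d: "d > 0" "\<And>z z'. z \<in> cball 0 R \<times> {0..T} \<Longrightarrow> z' \<in> cball 0 R \<times> {0..T} \<Longrightarrow>
     dist z' z < d \<Longrightarrow> dist (v z') (v z) < e"
    using assms(2) unfolding uniformly_continuous_on_def by metis
  show ?thesis
  proof (rule that[of "d / 2"])
    fix x y :: 'a and s t :: real
    assume *: "norm x \<le> R" "norm y \<le> R" "0 \<le> s" "s \<le> T" "0 \<le> t" "t \<le> T" "norm (y - x) < d / 2" "\<bar>s - t\<bar> < d / 2"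
    have "dist (y, s) (x, t) \<le> dist y x + dist s t"
      unfolding dist_prod_def using real_sqrt_sum_squares_triangle_ineq[of "dist y x" 0 0 "dist s t"] by simp
    then have "dist (y, s) (x, t) < d" using * by (simp add: dist_norm)
    then show "\<bar>v (y, s) - v (x, t)\<bar> \<le> e" using d(2)[of "(x, t)" "(y, s)"] * by (simp add: dist_real_def)
  qed (use d in auto)
qed

lemma pderivative_shift:
  assumes "\<And>k. Ck_function k P"
  shows "pderivative i (\<lambda>y. P (y - x)) y = pderivative i P (y - x)"
proof -
  have "((\<lambda>y. y - x) has_derivative (\<lambda>v. v)) (at y)" by (auto intro!: derivative_eq_intros)
  from diff_chain_at[OF this Ck_function_Suc_derivative(1)[OF assms]]
  have "((\<lambda>y. P (y - x)) has_derivative frechet_derivative P (at (y - x))) (at y)"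
    by (simp add: o_def)
  then show "pderivative i (\<lambda>y. P (y - x)) y = pderivative i P (y - x)"
    using frechet_derivative_at by metis
qed

lemma integral_shifted_support:
  fixes P :: "'a::euclidean_space \<Rightarrow> real"
  assumes "(P has_integral 1) UNIV" and "\<And>y. y + x \<notin> cbox c d \<Longrightarrow> P y = 0"
  shows "integral (cbox c d) (\<lambda>y. P (y - x)) = 1"
proof -
  have "(P has_integral 1) (cbox (c + - x) (d + - x))"
  proof (rule has_integral_on_support[OF assms(1)])
    fix y assume "y \<notin> cbox (c + - x) (d + - x)"
    then show "P y = 0" by (intro assms(2)) (auto simp: mem_box algebra_simps)
  qed
  then show ?thesis
    using has_integral_shift_cbox_iff[of P "- x" 1 c d] by (simp add: o_def integral_unique)
qed


text \<open>All that the comparison arguments use of the equation itself. \<open>D2 i\<close> is the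
  second derivative of \<open>A\<close> in direction i, so the sums are its Laplacian. Averaging the
  discontinuous source gives one-sided information: a bound from above everywhere since the
  indicator is at most 1, no source one unit outside the ball, and a bound from below only on a
  smaller ball of radius \<open>L'\<close>.\<close>

lemma approximation:
  fixes u :: "real^'n \<Rightarrow> real \<Rightarrow> real"
  assumes sol: "global_weak_solution m p L u0 u" and mp: "0 < m" "0 < p"
    and a: "0 < a" and e: "0 < e" and L': "L' < L"
  obtains A At :: "real^'n \<Rightarrow> real \<Rightarrow> real" and D1 D2 :: "'n \<Rightarrow> real^'n \<Rightarrow> real \<Rightarrow> real" and h :: real
  where "0 < h"
    and "\<And>x t. ((\<lambda>s. A x s) has_real_derivative At x t) (at t)"
    and "\<And>i x t. ((\<lambda>r. A (x + r *\<^sub>R axis i 1) t) has_real_derivative D1 i x t) (at 0)"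
    and "\<And>i x t. ((\<lambda>r. D1 i (x + r *\<^sub>R axis i 1) t) has_real_derivative D2 i x t) (at 0)"
    and "continuous_on UNIV (\<lambda>z. A (fst z) (snd z))"
    and "\<And>x t. norm x \<le> R \<Longrightarrow> a \<le> t \<Longrightarrow> t \<le> T \<Longrightarrow> \<bar>A x t - u x t powr m\<bar> \<le> e"
    and "\<And>x t. norm x \<le> R \<Longrightarrow> a \<le> t \<Longrightarrow> t \<le> T \<Longrightarrow>
           \<bar>At x t - (u x (t + h) powr m - u x t powr m) / h\<bar> \<le> e"
    and "\<And>x t. norm x \<le> R \<Longrightarrow> a \<le> t \<Longrightarrow> t \<le> T \<Longrightarrow>
           (u x (t + h) - u x t) / h - (\<Sum>i\<in>UNIV. D2 i x t) \<le> u x t powr p + e"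
    and "\<And>x t. norm x \<le> R \<Longrightarrow> L + 1 \<le> norm x \<Longrightarrow> a \<le> t \<Longrightarrow> t \<le> T \<Longrightarrow>
           (u x (t + h) - u x t) / h - (\<Sum>i\<in>UNIV. D2 i x t) \<le> e"
    and "\<And>x t. norm x \<le> R \<Longrightarrow> norm x \<le> L' \<Longrightarrow> a \<le> t \<Longrightarrow> t \<le> T \<Longrightarrow>
           u x t powr p - e \<le> (u x (t + h) - u x t) / h - (\<Sum>i\<in>UNIV. D2 i x t)"
    and "\<And>x t. norm x \<le> R \<Longrightarrow> a \<le> t \<Longrightarrow> t \<le> T \<Longrightarrow>
           \<bar>u x (t + h) powr m - u x t powr m\<bar> \<le> e"
proof -
  define U where "U = time_extension u"
  define w where "w = (\<lambda>z. U z powr m)"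
  define f where "f = (\<lambda>z. U z powr p)"
  have cU: "continuous_on UNIV U" and cw: "continuous_on UNIV w" and cf: "continuous_on UNIV f"
    unfolding U_def w_def f_def
    using continuous_time_extension[OF sol] continuous_time_extension_powr[OF sol] mp by auto
  have f0: "0 \<le> f z" for z by (simp add: f_def)
  have e2: "e / 2 > 0" using e by simp
  obtain \<eta>1 where \<eta>1: "\<eta>1 > 0" and w1: "\<And>x y s t. norm x \<le> R + 1 \<Longrightarrow> norm y \<le> R + 1 \<Longrightarrow> 0 \<le> s \<Longrightarrow> s \<le> T + 2
    \<Longrightarrow> 0 \<le> t \<Longrightarrow> t \<le> T + 2 \<Longrightarrow> norm (y - x) < \<eta>1 \<Longrightarrow> \<bar>s - t\<bar> < \<eta>1 \<Longrightarrow> \<bar>w (y, s) - w (x, t)\<bar> \<le> e / 2"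
    by (rule uniform_continuity_slab[OF cw e2, where R = "R + 1" and T = "T + 2"]) (rule that)
  obtain \<eta>2 where \<eta>2: "\<eta>2 > 0" and f1: "\<And>x y s t. norm x \<le> R + 1 \<Longrightarrow> norm y \<le> R + 1 \<Longrightarrow> 0 \<le> s \<Longrightarrow> s \<le> T + 2
    \<Longrightarrow> 0 \<le> t \<Longrightarrow> t \<le> T + 2 \<Longrightarrow> norm (y - x) < \<eta>2 \<Longrightarrow> \<bar>s - t\<bar> < \<eta>2 \<Longrightarrow> \<bar>f (y, s) - f (x, t)\<bar> \<le> e / 2"
    by (rule uniform_continuity_slab[OF cf e2, where R = "R + 1" and T = "T + 2"]) (rule that)
  \<comment> \<open>The kernel reaches from t - \<delta> to t + h + \<delta>, at most 2h away from
    t, so a quarter of the moduli leaves room for strict inequalities; 1/2 keeps these times below T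
    + 2.\<close>
  define h where "h = Min {\<eta>1 / 4, \<eta>2 / 4, 1 / 2}"
  have h: "0 < h" "4 * h \<le> \<eta>1" "4 * h \<le> \<eta>2" "2 * h \<le> 1"
    using \<eta>1 \<eta>2 by (auto simp: h_def min_def)
  have eh: "e * h / 4 > 0" using e h by simp
  obtain \<eta>3 where \<eta>3: "\<eta>3 > 0" and w2: "\<And>x y s t. norm x \<le> R + 1 \<Longrightarrow> norm y \<le> R + 1 \<Longrightarrow> 0 \<le> s \<Longrightarrow> s \<le> T + 2
    \<Longrightarrow> 0 \<le> t \<Longrightarrow> t \<le> T + 2 \<Longrightarrow> norm (y - x) < \<eta>3 \<Longrightarrow> \<bar>s - t\<bar> < \<eta>3 \<Longrightarrow> \<bar>w (y, s) - w (x, t)\<bar> \<le> e * h / 4"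
    by (rule uniform_continuity_slab[OF cw eh, where R = "R + 1" and T = "T + 2"]) (rule that)
  obtain \<eta>4 where \<eta>4: "\<eta>4 > 0" and U2: "\<And>x y s t. norm x \<le> R + 1 \<Longrightarrow> norm y \<le> R + 1 \<Longrightarrow> 0 \<le> s \<Longrightarrow> s \<le> T + 2
    \<Longrightarrow> 0 \<le> t \<Longrightarrow> t \<le> T + 2 \<Longrightarrow> norm (y - x) < \<eta>4 \<Longrightarrow> \<bar>s - t\<bar> < \<eta>4 \<Longrightarrow> \<bar>U (y, s) - U (x, t)\<bar> \<le> e * h / 4"
    by (rule uniform_continuity_slab[OF cU eh, where R = "R + 1" and T = "T + 2"]) (rule that)
  \<comment> \<open>The smoothing scale comes after h, for the accuracy e h / 4, because two such
    errors are added and divided by h. The entry a / 2 keeps the kernels at positive times, and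
    \<open>L - L'\<close> keeps those centred in the smaller ball inside the source.\<close>
  define \<delta> where "\<delta> = Min {\<eta>3, \<eta>4, h, a / 2, L - L'}"
  have \<delta>: "0 < \<delta>" "\<delta> \<le> \<eta>3" "\<delta> \<le> \<eta>4" "\<delta> \<le> h" "\<delta> \<le> a / 2" "\<delta> \<le> L - L'"
    using \<eta>3 \<eta>4 h a L' by (auto simp: \<delta>_def min_def)
  obtain P :: "real^'n \<Rightarrow> real" where P: "\<And>k. Ck_function k P" "\<And>y. 0 \<le> P y" "\<And>y. \<delta> \<le> norm y \<Longrightarrow> P y = 0"
    "(P has_integral 1) UNIV"
    by (rule exists_mollifier[OF \<delta>(1)]) (rule that)
  obtain \<tau> K :: "real \<Rightarrow> real" where
    \<tau>: "\<And>k. Ck_function k \<tau>" "\<And>s. 0 \<le> \<tau> s" "\<And>s. \<delta> \<le> \<bar>s\<bar> \<Longrightarrow> \<tau> s = 0" "(\<tau> has_integral 1) UNIV" and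
    K: "\<And>k. Ck_function k K" "\<And>s. 0 \<le> K s" "\<And>s. s \<le> - \<delta> \<or> h + \<delta> \<le> s \<Longrightarrow> K s = 0"
    "\<And>a b. a \<le> - \<delta> \<Longrightarrow> h + \<delta> \<le> b \<Longrightarrow> integral {a..b} K = 1" and
    dK: "\<And>s. (K has_real_derivative (\<tau> s - \<tau> (s - h)) / h) (at s)"
    by (rule exists_time_kernel[OF \<delta>(1) h(1)]) (rule that)
  note c\<tau> = Ck_function_imp_continuous[OF \<tau>(1)]
  note cK = Ck_function_imp_continuous[OF K(1)]
  note cP = Ck_function_imp_continuous[OF P(1)]
  have cdK: "continuous_on UNIV (\<lambda>s. (\<tau> s - \<tau> (s - h)) / h)"
    using h by (auto intro!: continuous_intros c\<tau> continuous_on_compose2[OF c\<tau>])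
  define B :: "real^'n" where "B = (\<Sum>i\<in>Basis. (R + 1) *\<^sub>R i)"
  have B: "y \<in> cbox (- B) B" if "norm y \<le> R + 1" for y
    using that Basis_le_norm[of _ y] by (force simp: mem_box B_def abs_le_iff)
  \<comment> \<open>The box contains the support of every kernel centred at norm x \<le> R and a
    \<le> t \<le> T, also after a shift by h, so these kernels have mass 1 on it.\<close>
  let ?C = "cbox (- B, a / 2) (B, T + 2)"
  define A where "A = kernel_avg ?C w P K"
  define G where "G = (\<lambda>v. kernel_avg ?C v P \<tau>)"
  define D2 where "D2 = (\<lambda>i. kernel_avg ?C w (pderivative i (pderivative i P)) K)"

  have Psupp: "norm (y - x) < \<delta>" if "P (y - x) \<noteq> 0" for x y
    using P(3)[of "y - x"] that by force
  have Ksupp: "- \<delta> < s - t \<and> s - t < h + \<delta>" if "K (s - t) \<noteq> 0" for s t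
    using K(3)[of "s - t"] that by force
  have \<tau>supp: "\<bar>s - t\<bar> < \<delta>" if "\<tau> (s - t) \<noteq> 0" for s t
    using \<tau>(3)[of "s - t"] that by force
  have near: "norm y \<le> R + 1" if "norm x \<le> R" "norm (y - x) < \<delta>" for x y :: "real^'n"
    using norm_triangle_sub[of y x] that \<delta> h by linarith
  have massP: "integral (cbox (- B) B) (\<lambda>y. P (y - x)) = 1" if "norm x \<le> R" for x
  proof (rule integral_shifted_support[OF P(4)])
    fix y assume "y + x \<notin> cbox (- B) B"
    then have "\<not> norm (y + x) \<le> R + 1" using B by blast
    then have "\<not> norm (y + x - x) < \<delta>" using near[OF that, of "y + x"] by blast
    then show "P y = 0" using P(3)[of y] by simp
  qed
  have massK: "integral ?C (\<lambda>z. P (fst z - x) * K (snd z - t)) = 1"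
    if "norm x \<le> R" "a \<le> t" "t \<le> T" for x t
  proof (rule kernel_mass[OF cP cK massP[OF that(1)]])
    show "integral {a / 2..T + 2} (\<lambda>s. K (s - t)) = 1"
      using integral_shift_Icc_real[of "a / 2" "T + 2" K "- t"] K(4)[of "a / 2 - t" "T + 2 - t"] that \<delta> h
      by (simp add: o_def)
  qed
  have mass\<tau>: "integral ?C (\<lambda>z. P (fst z - x) * \<tau> (snd z - t)) = 1"
    if "norm x \<le> R" "a \<le> t" "t \<le> T + h" for x t
  proof (rule kernel_mass[OF cP c\<tau> massP[OF that(1)]])
    have "integral (cbox (a / 2) (T + 2)) (\<lambda>s. \<tau> (s - t)) = 1"
    proof (rule integral_shifted_support[OF \<tau>(4)])
      fix s assume "s + t \<notin> cbox (a / 2) (T + 2)"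
      then have "\<delta> \<le> \<bar>s\<bar>" using that \<delta> h a by auto
      then show "\<tau> s = 0" by (rule \<tau>(3))
    qed
    then show "integral {a / 2..T + 2} (\<lambda>s. \<tau> (s - t)) = 1" by simp
  qed
  have Aclose: "\<bar>A x t - w (x, t)\<bar> \<le> e / 2" if xt: "norm x \<le> R" "a \<le> t" "t \<le> T" for x t
    unfolding A_def
  proof (rule kernel_avg_close[OF cw cP P(2) cK K(2) massK[OF xt]])
    fix y s assume "P (y - x) \<noteq> 0" "K (s - t) \<noteq> 0"
    note * = Psupp[OF this(1)] Ksupp[OF this(2)]
    show "\<bar>w (y, s) - w (x, t)\<bar> \<le> e / 2"
      by (rule w1) (use * xt near[OF xt(1) *(1)] \<delta> h a in linarith)+
  qed
  have Gclose: "\<bar>G w x t - w (x, t)\<bar> \<le> e * h / 4" "\<bar>G U x t - U (x, t)\<bar> \<le> e * h / 4"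
    if xt: "norm x \<le> R" "a \<le> t" "t \<le> T + h" for x t
    unfolding G_def
  proof -
    show "\<bar>kernel_avg ?C w P \<tau> x t - w (x, t)\<bar> \<le> e * h / 4"
    proof (rule kernel_avg_close[OF cw cP P(2) c\<tau> \<tau>(2) mass\<tau>[OF xt]])
      fix y s assume "P (y - x) \<noteq> 0" "\<tau> (s - t) \<noteq> 0"
      note * = Psupp[OF this(1)] \<tau>supp[OF this(2)]
      show "\<bar>w (y, s) - w (x, t)\<bar> \<le> e * h / 4"
        by (rule w2) (use * xt near[OF xt(1) *(1)] \<delta> h a in linarith)+
    qed
    show "\<bar>kernel_avg ?C U P \<tau> x t - U (x, t)\<bar> \<le> e * h / 4"
    proof (rule kernel_avg_close[OF cU cP P(2) c\<tau> \<tau>(2) mass\<tau>[OF xt]])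
      fix y s assume "P (y - x) \<noteq> 0" "\<tau> (s - t) \<noteq> 0"
      note * = Psupp[OF this(1)] \<tau>supp[OF this(2)]
      show "\<bar>U (y, s) - U (x, t)\<bar> \<le> e * h / 4"
        by (rule U2) (use * xt near[OF xt(1) *(1)] \<delta> h a in linarith)+
    qed
  qed
  have quot: "\<bar>(g' - g) / h - (v' - v) / h\<bar> \<le> e / 2" if "\<bar>g' - v'\<bar> \<le> e * h / 4" "\<bar>g - v\<bar> \<le> e * h / 4" for g g' v v'
  proof -
    have "e / 2 * h = 2 * (e * h / 4)" by simp
    then have "\<bar>(g' - g) - (v' - v)\<bar> \<le> e / 2 * h" using that by linarith
    then have "\<bar>((g' - g) - (v' - v)) / h\<bar> \<le> e / 2" using h by (simp add: abs_divide pos_divide_le_eq)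
    then show ?thesis by (simp add: diff_divide_distrib)
  qed
  \<comment> \<open>The averaged reaction; the weak identity, with the kernel as test function,
    equates it with a difference quotient minus the Laplacian of \<open>A\<close>.\<close>
  define F where "F = (\<lambda>x t. LINT z|lborel. indicator (ball 0 L) (fst z) * f z * (P (fst z - x) * K (snd z - t)))"
  have F: "integrable lborel (\<lambda>z. indicator (ball 0 L) (fst z) * f z * (P (fst z - x) * K (snd z - t)))"
    "F x t = (G U x (t + h) - G U x t) / h - (\<Sum>i\<in>UNIV. D2 i x t)"
    if xt: "norm x \<le> R" "a \<le> t" "t \<le> T" for x t
  proof -
    have Px: "P (y - x) = 0" if "y \<notin> cbox (- B) B" for y
      using that B near[OF xt(1)] Psupp by blast
    have Kt: "K (s - t) = 0" if "s \<notin> {a / 2..T + 2}" for s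
      using that xt \<delta> h a by (intro K(3)) auto
    have K't: "(\<tau> (s - t) - \<tau> (s - t - h)) / h = 0" if "s \<notin> {a / 2..T + 2}" for s
      using that xt \<delta> h a \<tau>(3)[of "s - t"] \<tau>(3)[of "s - t - h"] by auto
    have dKt: "((\<lambda>s. K (s - t)) has_real_derivative (\<tau> (s - t) - \<tau> (s - t - h)) / h) (at s)" for s
    proof -
      have "((\<lambda>s. s - t) has_real_derivative 1) (at s)" by (auto intro!: derivative_eq_intros)
      from DERIV_chain2[OF dK this] show ?thesis by simp
    qed
    have cdKt: "continuous_on UNIV (\<lambda>s. (\<tau> (s - t) - \<tau> (s - t - h)) / h)"
      using h by (auto intro!: continuous_intros continuous_on_compose2[OF c\<tau>])
    note weak = weak_identity[OF sol mp Ck_function_shift[OF P(1)] _ Ck_function_shift[OF K(1)] dKt cdKt _ _ half_gt_zero[OF a],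
        where c = "- B" and d = B and b = "T + 2",
        unfolded pderivative_shift[OF P(1)] pderivative_shift[OF Ck_function_pderivative[OF P(1)]], folded U_def]
    show "integrable lborel (\<lambda>z. indicator (ball 0 L) (fst z) * f z * (P (fst z - x) * K (snd z - t)))"
      unfolding f_def by (rule weak(1)) (use Px Kt K't in auto)
    have "kernel_avg ?C U P (\<lambda>s. (\<tau> s - \<tau> (s - h)) / h) x t + (\<Sum>i\<in>UNIV. D2 i x t) + F x t = 0"
      unfolding kernel_avg_def D2_def F_def f_def w_def by (rule weak(2)) (use Px Kt K't in auto)
    then show "F x t = (G U x (t + h) - G U x t) / h - (\<Sum>i\<in>UNIV. D2 i x t)"
      unfolding kernel_avg_time_difference[OF cU cP c\<tau>] by (simp add: G_def diff_divide_distrib)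
  qed
  have kint: "integrable lborel (\<lambda>z. c * (P (fst z - x) * K (snd z - t)))"
    "(LINT z|lborel. c * (P (fst z - x) * K (snd z - t))) = c"
    if xt: "norm x \<le> R" "a \<le> t" "t \<le> T" for x t c
  proof -
    have c: "continuous_on ?C (\<lambda>z. P (fst z - x) * K (snd z - t))"
      by (rule continuous_kernel[OF cP cK]) (intro continuous_intros)+
    have z: "P (fst z - x) * K (snd z - t) = 0" if "z \<notin> ?C" for z
    proof (rule ccontr)
      assume "\<not> ?thesis"
      then have nz: "P (fst z - x) \<noteq> 0" "K (snd z - t) \<noteq> 0" by auto
      have "fst z \<in> cbox (- B) B" using B near[OF xt(1) Psupp[OF nz(1)]] by blast
      moreover have "snd z \<in> {a / 2..T + 2}" using Ksupp[OF nz(2)] xt \<delta> h a by auto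
      ultimately show False using that by (cases z) auto
    qed
    note i = integral_eq_cbox_integral[OF c z]
    show "integrable lborel (\<lambda>z. c * (P (fst z - x) * K (snd z - t)))"
      using i(1) by simp
    show "(LINT z|lborel. c * (P (fst z - x) * K (snd z - t))) = c"
      using i massK[OF xt] by simp
  qed
  have Fle: "F x t \<le> c"
    if xt: "norm x \<le> R" "a \<le> t" "t \<le> T"
      and le: "\<And>y s. P (y - x) \<noteq> 0 \<Longrightarrow> K (s - t) \<noteq> 0 \<Longrightarrow> indicator (ball 0 L) y * f (y, s) \<le> c" for x t c
  proof -
    have "F x t \<le> (LINT z|lborel. c * (P (fst z - x) * K (snd z - t)))"
      unfolding F_def
    proof (rule integral_mono[OF F(1)[OF xt] kint(1)[OF xt]])
      fix z :: "(real^'n) \<times> real"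
      show "indicator (ball 0 L) (fst z) * f z * (P (fst z - x) * K (snd z - t)) \<le> c * (P (fst z - x) * K (snd z - t))"
      proof (cases "P (fst z - x) = 0 \<or> K (snd z - t) = 0")
        case False
        then show ?thesis
          using le[of "fst z" "snd z"] by (intro mult_right_mono mult_nonneg_nonneg P(2) K(2)) auto
      qed auto
    qed
    then show ?thesis by (simp only: kint(2)[OF xt])
  qed
  have Fge: "c \<le> F x t"
    if xt: "norm x \<le> R" "a \<le> t" "t \<le> T"
      and le: "\<And>y s. P (y - x) \<noteq> 0 \<Longrightarrow> K (s - t) \<noteq> 0 \<Longrightarrow> c \<le> indicator (ball 0 L) y * f (y, s)" for x t c
  proof -
    have "(LINT z|lborel. c * (P (fst z - x) * K (snd z - t))) \<le> F x t"
      unfolding F_def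
    proof (rule integral_mono[OF kint(1)[OF xt] F(1)[OF xt]])
      fix z :: "(real^'n) \<times> real"
      show "c * (P (fst z - x) * K (snd z - t)) \<le> indicator (ball 0 L) (fst z) * f z * (P (fst z - x) * K (snd z - t))"
      proof (cases "P (fst z - x) = 0 \<or> K (snd z - t) = 0")
        case False
        then show ?thesis
          using le[of "fst z" "snd z"] by (intro mult_right_mono mult_nonneg_nonneg P(2) K(2)) auto
      qed auto
    qed
    then show ?thesis by (simp only: kint(2)[OF xt])
  qed
  have fclose: "\<bar>f (y, s) - f (x, t)\<bar> \<le> e / 2"
    if xt: "norm x \<le> R" "a \<le> t" "t \<le> T" and nz: "P (y - x) \<noteq> 0" "K (s - t) \<noteq> 0" for x y s t
  proof -
    note * = Psupp[OF nz(1)] Ksupp[OF nz(2)]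
    show ?thesis
      by (rule f1) (use * xt near[OF xt(1) *(1)] \<delta> h a in linarith)+
  qed
  have F1: "F x t \<le> f (x, t) + e / 2" if xt: "norm x \<le> R" "a \<le> t" "t \<le> T" for x t
  proof (rule Fle[OF xt])
    fix y s assume "P (y - x) \<noteq> 0" "K (s - t) \<noteq> 0"
    from fclose[OF xt this] have "f (y, s) \<le> f (x, t) + e / 2" by linarith
    then show "indicator (ball 0 L) y * f (y, s) \<le> f (x, t) + e / 2"
      using f0[of "(x, t)"] e by (auto simp: indicator_def)
  qed
  \<comment> \<open>Since \<delta> \<le> h \<le> 1/2, a kernel centred one unit outside the ball
    misses it.\<close>
  have F2: "F x t \<le> 0" if xt: "norm x \<le> R" "a \<le> t" "t \<le> T" "L + 1 \<le> norm x" for x t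
  proof (rule Fle[OF xt(1-3)])
    fix y s assume "P (y - x) \<noteq> 0" "K (s - t) \<noteq> 0"
    from Psupp[OF this(1)] have "y \<notin> ball 0 L"
      using norm_triangle_sub[of x y] xt(4) \<delta> h by (simp add: norm_minus_commute)
    then show "indicator (ball 0 L) y * f (y, s) \<le> 0" by simp
  qed
  have F3: "f (x, t) - e / 2 \<le> F x t" if xt: "norm x \<le> R" "a \<le> t" "t \<le> T" "norm x \<le> L'" for x t
  proof (rule Fge[OF xt(1-3)])
    fix y s assume nz: "P (y - x) \<noteq> 0" "K (s - t) \<noteq> 0"
    from Psupp[OF nz(1)] have "y \<in> ball 0 L"
      using norm_triangle_sub[of y x] xt(4) \<delta> by simp
    then show "f (x, t) - e / 2 \<le> indicator (ball 0 L) y * f (y, s)"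
      using fclose[OF xt(1-3) nz] by (simp only: indicator_simps mult_1)
  qed
  have sv: "w (x, t) = u x t powr m" "U (x, t) = u x t" "f (x, t) = u x t powr p" if "0 \<le> t" for x t
    using that by (simp_all add: w_def U_def f_def)
  have Fquot: "\<bar>F x t - ((u x (t + h) - u x t) / h - (\<Sum>i\<in>UNIV. D2 i x t))\<bar> \<le> e / 2"
    if xt: "norm x \<le> R" "a \<le> t" "t \<le> T" for x t
    using quot[OF Gclose(2)[of x "t + h"] Gclose(2)[of x t]] xt h a F(2)[OF xt] sv[of t x] sv[of "t + h" x] by simp
  show ?thesis
  proof (rule that[of h A "\<lambda>x t. (G w x (t + h) - G w x t) / h" "\<lambda>i x t. - kernel_avg ?C w (pderivative i P) K x t" D2])
    show "((\<lambda>s. A x s) has_real_derivative (G w x (t + h) - G w x t) / h) (at t)" for x t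
      using kernel_avg_time_derivative[OF cw cP dK cdK, of "(- B, a / 2)" "(B, T + 2)" x t]
      unfolding kernel_avg_time_difference[OF cw cP c\<tau>] by (simp add: A_def G_def diff_divide_distrib)
    show "((\<lambda>r. A (x + r *\<^sub>R axis i 1) t) has_real_derivative - kernel_avg ?C w (pderivative i P) K x t) (at 0)" for i x t
      unfolding A_def by (rule kernel_avg_space_derivative[OF cw P(1) cK])
    show "((\<lambda>r. - kernel_avg ?C w (pderivative i P) K (x + r *\<^sub>R axis i 1) t) has_real_derivative D2 i x t) (at 0)" for i x t
      using DERIV_minus[OF kernel_avg_space_derivative[OF cw Ck_function_pderivative[OF P(1)] cK]]
      unfolding D2_def by simp
    show "continuous_on UNIV (\<lambda>z. A (fst z) (snd z))"
      unfolding A_def by (rule continuous_kernel_avg[OF cw cP cK])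
  next
    fix x :: "real^'n" and t :: real assume xt: "norm x \<le> R" "a \<le> t" "t \<le> T"
    then have t: "0 \<le> t" "0 \<le> t + h" using a h by auto
    show "\<bar>A x t - u x t powr m\<bar> \<le> e" using Aclose[OF xt] sv(1)[OF t(1)] e by simp
    show "\<bar>(G w x (t + h) - G w x t) / h - (u x (t + h) powr m - u x t powr m) / h\<bar> \<le> e"
      using quot[OF Gclose(1)[of x "t + h"] Gclose(1)[of x t]] xt h a sv(1)[OF t(1)] sv(1)[OF t(2)] e by simp
    show "(u x (t + h) - u x t) / h - (\<Sum>i\<in>UNIV. D2 i x t) \<le> u x t powr p + e"
      using F1[OF xt] Fquot[OF xt] sv(3)[OF t(1), of x] by linarith
    show "\<bar>u x (t + h) powr m - u x t powr m\<bar> \<le> e"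
      using w1[of x x "t + h" t] xt h a \<eta>1 sv(1)[OF t(1)] sv(1)[OF t(2)] e by simp
  next
    fix x :: "real^'n" and t :: real assume xt: "norm x \<le> R" "L + 1 \<le> norm x" "a \<le> t" "t \<le> T"
    show "(u x (t + h) - u x t) / h - (\<Sum>i\<in>UNIV. D2 i x t) \<le> e"
      using F2[OF xt(1,3,4,2)] Fquot[OF xt(1,3,4)] e by linarith
  next
    fix x :: "real^'n" and t :: real assume xt: "norm x \<le> R" "norm x \<le> L'" "a \<le> t" "t \<le> T"
    show "u x t powr p - e \<le> (u x (t + h) - u x t) / h - (\<Sum>i\<in>UNIV. D2 i x t)"
      using F3[OF xt(1,3,4,2)] Fquot[OF xt(1,3,4)] sv(3)[OF order_trans[OF less_imp_le[OF a] xt(3)], of x] by linarith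
  qed (use h in auto)
qed

section \<open>First touching points\<close>

text \<open>The first derivative vanishes at the maximum. If c were positive it would be positive
  just to the right, and the mean value theorem would push g above its maximum.\<close>

lemma second_derivative_nonpos_at_max:
  fixes g g1 :: "real \<Rightarrow> real"
  assumes g: "\<And>s. (g has_real_derivative g1 s) (at s)" and g1: "(g1 has_real_derivative c) (at 0)"
    and max: "d > 0" "\<And>s. \<bar>s\<bar> < d \<Longrightarrow> g s \<le> g 0"
  shows "c \<le> 0"
proof (rule ccontr)
  assume "\<not> c \<le> 0"
  then obtain d' where d': "d' > 0" "\<And>h. 0 < h \<Longrightarrow> h < d' \<Longrightarrow> g1 0 < g1 (0 + h)"
    using DERIV_pos_inc_right[OF g1] by auto
  have "g1 0 = 0" by (rule DERIV_local_max[OF g max(1)]) (use max in auto)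
  define s where "s = min d d' / 2"
  have s: "0 < s" "s < d" "s < d'" using max d' by (auto simp: s_def min_def)
  obtain \<xi> where "0 < \<xi>" "\<xi> < s" "g s - g 0 = (s - 0) * g1 \<xi>"
    using MVT2[OF s(1), of g g1] g by blast
  moreover have "0 < s * g1 \<xi>" using calculation d'(2)[of \<xi>] s \<open>g1 0 = 0\<close> by simp
  ultimately show False using max(2)[of s] s by simp
qed

lemma axis_second_derivative_nonpos_at_max:
  fixes H :: "real^'n \<Rightarrow> real"
  assumes H1: "\<And>x. ((\<lambda>r. H (x + r *\<^sub>R axis i 1)) has_real_derivative H1 x) (at 0)"
    and H2: "((\<lambda>r. H1 (x + r *\<^sub>R axis i 1)) has_real_derivative c) (at 0)"
    and max: "d > 0" "\<And>y. norm (y - x) < d \<Longrightarrow> H y \<le> H x"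
  shows "c \<le> 0"
proof (rule second_derivative_nonpos_at_max[OF _ H2 max(1)])
  fix s :: real
  show "((\<lambda>r. H (x + r *\<^sub>R axis i 1)) has_real_derivative H1 (x + s *\<^sub>R axis i 1)) (at s)"
    using H1[of "x + s *\<^sub>R axis i 1"] DERIV_shift[of "\<lambda>r. H (x + r *\<^sub>R axis i 1)" _ 0 s]
    by (simp add: algebra_simps)
  show "H (x + s *\<^sub>R axis i 1) \<le> H (x + 0 *\<^sub>R axis i 1)" if "\<bar>s\<bar> < d"
    using max(2)[of "x + s *\<^sub>R axis i 1"] that by simp
qed

text \<open>Compactness gives an earliest point where H is nonnegative. There H is 0 and maximal in
  space, and it was negative before, whence the signs of the derivatives. These signs are not
  strict, so \<open>touch\<close> must draw its contradiction from a margin in the barrier.\<close>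

lemma parabolic_touching:
  fixes H Ht :: "real^'n \<Rightarrow> real \<Rightarrow> real"
  assumes cont: "continuous_on (cball 0 R \<times> {a..T}) (\<lambda>z. H (fst z) (snd z))"
    and Ht: "\<And>x t. a \<le> t \<Longrightarrow> t \<le> T \<Longrightarrow> ((\<lambda>s. H x s) has_real_derivative Ht x t) (at t)"
    and H1: "\<And>i x t. a \<le> t \<Longrightarrow> t \<le> T \<Longrightarrow> ((\<lambda>r. H (x + r *\<^sub>R axis i 1) t) has_real_derivative H1 i x t) (at 0)"
    and H2: "\<And>i x t. a \<le> t \<Longrightarrow> t \<le> T \<Longrightarrow> ((\<lambda>r. H1 i (x + r *\<^sub>R axis i 1) t) has_real_derivative H2 i x t) (at 0)"
    and init: "\<And>x. norm x \<le> R \<Longrightarrow> H x a < 0"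
    and bdry: "\<And>x t. norm x = R \<Longrightarrow> a \<le> t \<Longrightarrow> t \<le> T \<Longrightarrow> H x t < 0"
    and touch: "\<And>x t. norm x < R \<Longrightarrow> a < t \<Longrightarrow> t \<le> T \<Longrightarrow> H x t = 0 \<Longrightarrow> 0 \<le> Ht x t \<Longrightarrow>
       (\<And>i. H2 i x t \<le> 0) \<Longrightarrow> False"
    and xt: "norm x \<le> R" "a \<le> t" "t \<le> T"
  shows "H x t < 0"
proof (rule ccontr)
  assume not: "\<not> H x t < 0"
  define S where "S = (cball 0 R \<times> {a..T}) \<inter> {z. 0 \<le> H (fst z) (snd z)}"
  have "S = {z \<in> cball 0 R \<times> {a..T}. 0 \<le> H (fst z) (snd z)}" by (auto simp: S_def)
  moreover have "closed {z \<in> cball 0 R \<times> {a..T}. 0 \<le> H (fst z) (snd z)}"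
    by (intro continuous_on_closed_Collect_le cont continuous_intros closed_Times) auto
  ultimately have "closed S" by simp
  then have "compact S"
    using compact_Int_closed[OF compact_Times[OF compact_cball compact_Icc], of S 0 R a T]
    by (simp add: S_def Int_assoc[symmetric])
  moreover have "(x, t) \<in> S" using not xt by (simp add: S_def)
  moreover have "continuous_on S snd" by (intro continuous_intros)
  ultimately have "\<exists>z0\<in>S. \<forall>z\<in>S. snd z0 \<le> snd z"
    using continuous_attains_inf[of S snd] by blast
  then obtain z0 where z0: "z0 \<in> S" "\<And>z. z \<in> S \<Longrightarrow> snd z0 \<le> snd z" by blast
  define y s where "y = fst z0" and "s = snd z0"
  have ys: "norm y \<le> R" "a \<le> s" "s \<le> T" "0 \<le> H y s" using z0(1) by (auto simp: S_def y_def s_def)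
  have before: "H y' s' < 0" if "norm y' \<le> R" "a \<le> s'" "s' < s" for y' s'
    using z0(2)[of "(y', s')"] that ys by (force simp: S_def s_def)
  have "s \<noteq> a" using init[of y] ys by force
  then have s: "a < s" using ys by simp
  \<comment> \<open>A positive value at time s would persist slightly earlier by continuity in time,
    against the minimality of s.\<close>
  have upto: "H y' s \<le> 0" if y': "norm y' \<le> R" for y'
  proof (rule ccontr)
    assume "\<not> H y' s \<le> 0"
    then have pos: "0 < H y' s" by simp
    have "isCont (\<lambda>s. H y' s) s" using Ht[of s y'] ys DERIV_isCont by blast
    then have "\<forall>\<^sub>F r in nhds s. 0 < H y' r"
      using pos by (metis isCont_def order_tendstoD(1) tendsto_at_iff_tendsto_nhds)
    then have "\<forall>\<^sub>F r in at_left s. 0 < H y' r" by (simp add: eventually_at_filter eventually_mono)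
    moreover have "\<forall>\<^sub>F r in at_left s. r \<in> {a<..<s}"
      by (rule eventually_at_leftI[OF _ s]) auto
    ultimately have "\<forall>\<^sub>F r in at_left s. False"
    proof eventually_elim
      case (elim r)
      then show False using before[OF y', of r] by auto
    qed
    then show False by (simp add: trivial_limit_at_left_real)
  qed
  have H0: "H y s = 0" using upto[OF ys(1)] ys(4) by simp
  have yR: "norm y < R" using bdry[of y s] ys by fastforce
  have "0 \<le> Ht y s"
  proof (rule ccontr)
    assume "\<not> 0 \<le> Ht y s"
    then obtain d where d: "d > 0" "\<And>h. 0 < h \<Longrightarrow> h < d \<Longrightarrow> H y s < H y (s - h)"
      using DERIV_neg_dec_left[OF Ht[OF ys(2,3)], of y] by auto
    define h where "h = min d (s - a) / 2"
    have h: "0 < h" "h < d" "h \<le> s - a" using d(1) s by (auto simp: h_def min_def)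
    then show False using d(2)[OF h(1,2)] before[OF ys(1), of "s - h"] H0 by simp
  qed
  moreover have "H2 i y s \<le> 0" for i
  proof (rule axis_second_derivative_nonpos_at_max[OF H1[OF ys(2,3)] H2[OF ys(2,3)]])
    show "0 < R - norm y" using yR by simp
    show "H y' s \<le> H y s" if "norm (y' - y) < R - norm y" for y'
      using upto[of y'] norm_triangle_sub[of y' y] that H0 by simp
  qed
  ultimately show False using touch[OF yR s ys(3) H0] by blast
qed

text \<open>The mean value theorem with the increasing derivative of a convex power. The slope at
  the earlier value serves the comparison from above, where w is bounded below by the barrier; the
  slope at the later value serves the one from below.\<close>

lemma powr_tangent:
  fixes w w' :: real
  assumes "0 < w" "w \<le> w'" "1 \<le> \<alpha>"
  shows "\<alpha> * w powr (\<alpha> - 1) * (w' - w) \<le> w' powr \<alpha> - w powr \<alpha>"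
    and "w' powr \<alpha> - w powr \<alpha> \<le> \<alpha> * w' powr (\<alpha> - 1) * (w' - w)"
proof -
  have "\<alpha> * w powr (\<alpha> - 1) * (w' - w) \<le> w' powr \<alpha> - w powr \<alpha> \<and>
    w' powr \<alpha> - w powr \<alpha> \<le> \<alpha> * w' powr (\<alpha> - 1) * (w' - w)"
  proof (cases "w = w'")
    case False
    then have "w < w'" using assms by simp
    then obtain \<xi> where \<xi>: "w < \<xi>" "\<xi> < w'" "w' powr \<alpha> - w powr \<alpha> = (w' - w) * (\<alpha> * \<xi> powr (\<alpha> - 1))"
      using MVT2[of w w' "\<lambda>x. x powr \<alpha>" "\<lambda>x. \<alpha> * x powr (\<alpha> - 1)"] assms
      by (force intro!: derivative_eq_intros)
    then show ?thesis using assms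
      by (auto simp: mult_ac intro!: mult_left_mono powr_mono2)
  qed auto
  then show "\<alpha> * w powr (\<alpha> - 1) * (w' - w) \<le> w' powr \<alpha> - w powr \<alpha>"
    "w' powr \<alpha> - w powr \<alpha> \<le> \<alpha> * w' powr (\<alpha> - 1) * (w' - w)" by auto
qed

section \<open>Barriers\<close>

lemma bounded_solution:
  assumes "global_weak_solution m p L u0 u" "0 \<le> T"
  obtains M where "0 \<le> M" "\<And>x t. 0 \<le> t \<Longrightarrow> t \<le> T \<Longrightarrow> u x t \<le> M"
proof -
  have "bounded {u x s |x s. 0 \<le> s \<and> s \<le> T}"
    using assms by (auto simp: global_weak_solution_def)
  then obtain M where M: "0 < M" "\<forall>v\<in>{u x s |x s. 0 \<le> s \<and> s \<le> T}. norm v \<le> M"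
    unfolding bounded_pos by blast
  show ?thesis
  proof (rule that[of M])
    fix x t assume "0 \<le> t" "t \<le> T"
    then have "norm (u x t) \<le> M" by (intro bspec[OF M(2)]) blast
    then show "u x t \<le> M" by simp
  qed (use M in simp)
qed

text \<open>The product formula is g' = c g^p for g = S^(1/m), rewritten in S, the form in which the
  tangent inequality produces it. The last bound limits the errors in the comparison from above; it
  holds for either sign of the exponent q m - 1 because the base is at least 1.\<close>

lemma grow_up_profile:
  fixes m p c G :: real
  assumes "0 < m" "m < p" "p < 1" "0 < c"
  defines "q \<equiv> 1 / (1 - p)"
  defines "S \<equiv> \<lambda>t. (G + (1 - p) * c * t) powr (q * m)"
    and "S' \<equiv> \<lambda>t. m * c * (G + (1 - p) * c * t) powr (q * m - 1)"
  assumes t: "1 \<le> G + (1 - p) * c * t"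
  shows "(S has_real_derivative S' t) (at t)"
    and "0 < S' t" and "1 \<le> S t"
    and "1 / m * S t powr (1 / m - 1) * S' t = c * S t powr (p / m)"
    and "S t powr (1 / m) = (G + (1 - p) * c * t) powr q"
    and "m * c / (G + (1 - p) * c * t) \<le> S' t"
proof -
  let ?B = "G + (1 - p) * c * t"
  have q: "q * (1 - p) = 1" "q > 0" "q * p = q - 1"
    using assms(2,3) by (auto simp: q_def field_simps)
  have qc: "q * m * ((1 - p) * c) = m * c" using q(1) by (metis mult.assoc mult.commute mult.left_commute mult_1)
  show "(S has_real_derivative S' t) (at t)"
  proof -
    have "((\<lambda>t. G + (1 - p) * c * t) has_real_derivative (1 - p) * c) (at t)"
      by (auto intro!: derivative_eq_intros)
    from DERIV_fun_powr[OF this, of "q * m"]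
    have "(S has_real_derivative q * m * ?B powr (q * m - 1) * ((1 - p) * c)) (at t)"
      using t by (simp add: S_def)
    also have "q * m * ?B powr (q * m - 1) * ((1 - p) * c) = q * m * ((1 - p) * c) * ?B powr (q * m - 1)"
      by (simp only: mult_ac)
    finally show ?thesis unfolding qc S'_def .
  qed
  show "0 < S' t" unfolding S'_def using t assms(1,4) by simp
  show "1 \<le> S t" unfolding S_def using t q assms(1) by (simp add: ge_one_powr_ge_zero)
  show "S t powr (1 / m) = ?B powr q"
    unfolding S_def using assms(1) by (simp add: powr_powr)
  have "S t powr (1 / m - 1) = ?B powr (q - q * m)"
  proof -
    have "q * m * (1 / m - 1) = q - q * m" using assms(1) by (simp add: right_diff_distrib)
    then show ?thesis unfolding S_def powr_powr by simp
  qed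
  then have "1 / m * S t powr (1 / m - 1) * S' t = c * (?B powr (q - q * m) * ?B powr (q * m - 1))"
    unfolding S'_def using assms(1) by simp
  also have "\<dots> = c * ?B powr (q - 1)" by (simp add: powr_add[symmetric])
  also have "\<dots> = c * S t powr (p / m)"
    unfolding S_def powr_powr using assms(1) q(3) by (simp add: mult.assoc)
  finally show "1 / m * S t powr (1 / m - 1) * S' t = c * S t powr (p / m)" .
  have "?B powr (- 1) \<le> ?B powr (q * m - 1)"
    using t q(2) assms(1) by (intro powr_mono) auto
  then have "1 / ?B \<le> ?B powr (q * m - 1)"
    using t by (simp add: powr_minus_divide)
  then have "m * c * (1 / ?B) \<le> S' t"
    unfolding S'_def using assms(1,4) by (intro mult_left_mono) auto
  then show "m * c / ?B \<le> S' t" by simp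
qed

lemma norm_square_axis_derivative:
  fixes x :: "real^'n"
  shows "((\<lambda>r. (x + r *\<^sub>R axis i 1) \<bullet> (x + r *\<^sub>R axis i 1)) has_real_derivative 2 * x $ i) (at 0)"
proof -
  have "(x + r *\<^sub>R axis i 1) \<bullet> (x + r *\<^sub>R axis i 1) = x \<bullet> x + 2 * x $ i * r + r * r" for r
    by (simp add: inner_add_left inner_add_right inner_axis inner_axis' inner_axis_axis algebra_simps)
  then show ?thesis by (auto intro!: derivative_eq_intros)
qed

section \<open>Comparison from above on large balls\<close>

text \<open>In space the solution is only known to be bounded up to each T, so the quadratic term
  closes the barrier on a ball whose radius depends on T; \<epsilon>, c and G do not, and the final
  constant inherits this. The comparison starts at time 1 because the approximation needs positive
  times.\<close>

lemma upper_bound: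
  fixes u :: "real^'n \<Rightarrow> real \<Rightarrow> real"
  assumes sol: "global_weak_solution m p L u0 u" and mp: "0 < m" "m < p" "p < 1" and L: "0 < L"
  obtains C where "0 < C" "\<And>x (t::real). 1 \<le> t \<Longrightarrow> norm x \<le> L \<Longrightarrow> u x t \<le> C * t powr (1 / (1 - p))"
proof -
  define q where "q = 1 / (1 - p)"
  have p0: "0 < p" using mp by simp
  \<comment> \<open>The factor 2^(1/m) pays for w \<ge> S/2 in the slope and for halving S'. In the
    bracket, 2^(p/m) matches the reaction at w \<le> 2 S, and the extra 2 beats the Laplacian and
    the error, together at most 1/2.\<close>
  define c where "c = 2 powr (1 / m) * (2 + 2 powr (p / m))"
  have c: "0 < c" by (simp add: c_def add_pos_pos)
  have q: "0 < q" using mp by (simp add: q_def)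
  obtain M0 where M0: "0 \<le> M0" "\<And>x t. 0 \<le> t \<Longrightarrow> t \<le> 1 \<Longrightarrow> u x t \<le> M0"
    by (rule bounded_solution[OF sol, of 1]) (auto intro: that)
  \<comment> \<open>This makes S at time 0 equal to M0^m + 2, above \<open>u^m\<close> up to time 1,
    and keeps the base of the profile at least 1.\<close>
  define G where "G = (M0 powr m + 2) powr (1 / (q * m))"
  have G: "1 \<le> G" "G powr (q * m) = M0 powr m + 2"
    using q mp powr_ge_zero[of M0 m] by (auto simp: G_def powr_powr ge_one_powr_ge_zero)
  define B where "B = (\<lambda>t. G + (1 - p) * c * t)"
  define S where "S = (\<lambda>t. B t powr (q * m))"
  define S' where "S' = (\<lambda>t. m * c * B t powr (q * m - 1))"
  have B1: "1 \<le> B t" if "0 \<le> t" for t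
    unfolding B_def using G(1) that mp c by (simp add: add_increasing2)
  have prof: "(S has_real_derivative S' t) (at t)" "0 < S' t" "1 \<le> S t"
    "1 / m * S t powr (1 / m - 1) * S' t = c * S t powr (p / m)"
    "S t powr (1 / m) = B t powr q" "m * c / B t \<le> S' t" if "0 \<le> t" for t
    unfolding S_def S'_def B_def q_def
    by (rule grow_up_profile[OF mp c B1[OF that, unfolded B_def]])+
  have main: "u x T \<le> (2 * S T) powr (1 / m)" if T: "1 \<le> T" and x: "norm x \<le> L" for x T
  proof -
    obtain M1 where M1: "0 \<le> M1" "\<And>x t. 0 \<le> t \<Longrightarrow> t \<le> T \<Longrightarrow> u x t \<le> M1"
      by (rule bounded_solution[OF sol, of T]) (use T in \<open>auto intro: that\<close>)
    define N where "N = real CARD('n)"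
    have N: "0 < N" by (simp add: N_def)
    \<comment> \<open>The Laplacian 2 N \<epsilon> of the quadratic term, and its size on the ball
      of radius L + 1, are both at most 1/4.\<close>
    define \<epsilon> where "\<epsilon> = 1 / (8 * N + 4 * (L + 1)\<^sup>2)"
    have den: "0 < 8 * N + 4 * (L + 1)\<^sup>2" using N by (intro add_pos_nonneg) auto
    have \<epsilon>: "0 < \<epsilon>" "2 * N * \<epsilon> \<le> 1 / 4" "\<epsilon> * (L + 1)\<^sup>2 \<le> 1 / 4"
      using den N by (auto simp: \<epsilon>_def field_simps)
    \<comment> \<open>On the sphere of radius R the quadratic term alone exceeds every value of
      \<open>u^m\<close> up to time T.\<close>
    define R where "R = sqrt ((M1 powr m + 2) / \<epsilon>) + (L + 1)"
    have R: "L + 1 \<le> R" "M1 powr m + 2 \<le> \<epsilon> * R\<^sup>2"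
    proof -
      have nn: "0 \<le> (M1 powr m + 2) / \<epsilon>" using \<epsilon> by (intro divide_nonneg_pos add_nonneg_nonneg) auto
      then show "L + 1 \<le> R" by (simp add: R_def)
      have "(sqrt ((M1 powr m + 2) / \<epsilon>))\<^sup>2 \<le> R\<^sup>2"
        unfolding R_def using nn L by (intro power_mono) auto
      then have "(M1 powr m + 2) / \<epsilon> \<le> R\<^sup>2" using nn by simp
      then show "M1 powr m + 2 \<le> \<epsilon> * R\<^sup>2" using \<epsilon> by (simp add: field_simps)
    qed
    define r where "r = m * c / B T"
    have "0 < r" unfolding r_def using mp c B1[of T] T by simp
    \<comment> \<open>On [1, T] the derivative S' is at least r, so an error of r / 2 leaves at
      least half of S' in the quotient of w.\<close>
    define e where "e = min (1 / 4) (r / 2)"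
    have e: "0 < e" "e \<le> 1 / 4" "2 * e \<le> r"
      using \<open>0 < r\<close> by (auto simp: e_def)
    have eS: "2 * e \<le> S' t" if "1 \<le> t" "t \<le> T" for t
    proof -
      have "B t \<le> B T" unfolding B_def using that mp c by simp
      then have "m * c / B T \<le> m * c / B t"
        using B1[of t] that mp c by (intro divide_left_mono) auto
      moreover have "m * c / B t \<le> S' t" using that by (intro prof) simp
      ultimately show ?thesis using e(3) unfolding r_def by (meson order_trans)
    qed
    obtain A At :: "real^'n \<Rightarrow> real \<Rightarrow> real" and D1 D2 :: "'n \<Rightarrow> real^'n \<Rightarrow> real \<Rightarrow> real" and h :: real where
      h: "0 < h"
      and At: "\<And>x t. ((\<lambda>s. A x s) has_real_derivative At x t) (at t)"
      and D1: "\<And>i x t. ((\<lambda>r. A (x + r *\<^sub>R axis i 1) t) has_real_derivative D1 i x t) (at 0)"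
      and D2: "\<And>i x t. ((\<lambda>r. D1 i (x + r *\<^sub>R axis i 1) t) has_real_derivative D2 i x t) (at 0)"
      and contA: "continuous_on UNIV (\<lambda>z. A (fst z) (snd z))"
      and Aw: "\<And>x t. norm x \<le> R \<Longrightarrow> 1 \<le> t \<Longrightarrow> t \<le> T \<Longrightarrow> \<bar>A x t - u x t powr m\<bar> \<le> e"
      and Atw: "\<And>x t. norm x \<le> R \<Longrightarrow> 1 \<le> t \<Longrightarrow> t \<le> T \<Longrightarrow>
           \<bar>At x t - (u x (t + h) powr m - u x t powr m) / h\<bar> \<le> e"
      and F1: "\<And>x t. norm x \<le> R \<Longrightarrow> 1 \<le> t \<Longrightarrow> t \<le> T \<Longrightarrow>
           (u x (t + h) - u x t) / h - (\<Sum>i\<in>UNIV. D2 i x t) \<le> u x t powr p + e"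
      and F2: "\<And>x t. norm x \<le> R \<Longrightarrow> L + 1 \<le> norm x \<Longrightarrow> 1 \<le> t \<Longrightarrow> t \<le> T \<Longrightarrow>
           (u x (t + h) - u x t) / h - (\<Sum>i\<in>UNIV. D2 i x t) \<le> e"
      by (rule approximation[OF sol mp(1) p0 zero_less_one e(1) L, where R = R and T = T]) (rule that)
    have u0: "0 \<le> u x t" if "0 \<le> t" for x t
      using sol that by (simp add: global_weak_solution_def)
    define H where "H = (\<lambda>x t. A x t - (S t + \<epsilon> * (x \<bullet> x)))"
    have touching: "H y t < 0" if yt: "norm y \<le> R" "1 \<le> t" "t \<le> T" for y t
    proof (rule parabolic_touching[of R 1 T H "\<lambda>x t. At x t - S' t" "\<lambda>i x t. D1 i x t - \<epsilon> * (2 * x $ i)"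
          "\<lambda>i x t. D2 i x t - 2 * \<epsilon>", OF _ _ _ _ _ _ _ yt])
      have "continuous_on {1..T} S"
        by (rule DERIV_continuous_on[of _ _ S']) (use prof(1) in \<open>auto intro: has_field_derivative_at_within\<close>)
      then have "continuous_on (cball 0 R \<times> {1..T}) (\<lambda>z. S (snd z))"
        by (rule continuous_on_compose2) (auto intro!: continuous_intros)
      then show "continuous_on (cball 0 R \<times> {1..T}) (\<lambda>z. H (fst z) (snd z))"
        unfolding H_def by (intro continuous_intros continuous_on_subset[OF contA]) auto
    next
      fix x t assume t: "(1::real) \<le> t" "t \<le> T"
      show "((\<lambda>s. H x s) has_real_derivative At x t - S' t) (at t)"
        unfolding H_def using prof(1)[of t] t At[of x t]
        by (auto intro!: derivative_eq_intros)
      fix i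
      show "((\<lambda>r. H (x + r *\<^sub>R axis i 1) t) has_real_derivative D1 i x t - \<epsilon> * (2 * x $ i)) (at 0)"
        unfolding H_def
        using DERIV_diff[OF D1 DERIV_add[OF DERIV_const DERIV_cmult[OF norm_square_axis_derivative]]] by simp
      show "((\<lambda>r. D1 i (x + r *\<^sub>R axis i 1) t - \<epsilon> * (2 * (x + r *\<^sub>R axis i 1) $ i)) has_real_derivative D2 i x t - 2 * \<epsilon>) (at 0)"
        by (intro DERIV_diff D2) (auto intro!: derivative_eq_intros)
    next
      fix x :: "real^'n" assume x: "norm x \<le> R"
      have "A x 1 \<le> u x 1 powr m + e" using Aw[OF x, of 1] T by linarith
      also have "u x 1 powr m \<le> M0 powr m" using M0(2)[of 1 x] u0[of 1 x] mp by (intro powr_mono2) auto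
      also have "M0 powr m + e < S 1"
      proof -
        have "G powr (q * m) \<le> S 1" unfolding S_def B_def using G(1) q mp c by (intro powr_mono2) auto
        then show ?thesis using G(2) e by simp
      qed
      also have "S 1 \<le> S 1 + \<epsilon> * (x \<bullet> x)" using \<epsilon> by simp
      finally show "H x 1 < 0" by (simp add: H_def)
    next
      fix x :: "real^'n" and t assume x: "norm x = R" and t: "1 \<le> t" "t \<le> T"
      have "A x t \<le> u x t powr m + e" using Aw[of x t] x t by force
      also have "u x t powr m \<le> M1 powr m" using M1(2)[of t x] u0[of t x] mp t by (intro powr_mono2) auto
      also have "M1 powr m + e < \<epsilon> * (x \<bullet> x)" using R(2) x e by (simp add: power2_norm_eq_inner[symmetric])
      also have "\<dots> \<le> S t + \<epsilon> * (x \<bullet> x)" using prof(3)[of t] t by simp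
      finally show "H x t < 0" by (simp add: H_def)
    next
      fix x :: "real^'n" and t assume x: "norm x < R" and t: "1 < t" "t \<le> T" and H0: "H x t = 0"
        and Ht: "0 \<le> At x t - S' t" and H2: "\<And>i. D2 i x t - 2 * \<epsilon> \<le> 0"
      have xt: "norm x \<le> R" "1 \<le> t" "t \<le> T" using x t by auto
      have "0 \<le> t" using t by simp
      note pr = prof[OF this]
      define w where "w = u x t powr m"
      define w' where "w' = u x (t + h) powr m"
      have uw: "u x t = w powr (1 / m)" "u x (t + h) = w' powr (1 / m)"
        using u0[of t x] u0[of "t + h" x] t h mp by (auto simp: w_def w'_def powr_powr)
      have Sx: "A x t = S t + \<epsilon> * (x \<bullet> x)" using H0 by (simp add: H_def)
      have Aw': "\<bar>A x t - w\<bar> \<le> e" using Aw[OF xt] by (simp add: w_def)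
      have "0 \<le> \<epsilon> * (x \<bullet> x)" using \<epsilon> by simp
      then have wS: "S t / 2 \<le> w" using Aw' Sx e pr(3) by linarith
      have sumD2: "(\<Sum>i\<in>UNIV. D2 i x t) \<le> 1 / 4"
      proof -
        have "(\<Sum>i\<in>UNIV. D2 i x t) \<le> (\<Sum>i\<in>(UNIV :: 'n set). 2 * \<epsilon>)"
          using H2 by (intro sum_mono) simp
        also have "\<dots> = 2 * N * \<epsilon>" by (simp add: N_def)
        finally show ?thesis using \<epsilon>(2) by simp
      qed
      have quot: "S' t / 2 \<le> (w' - w) / h"
        using Atw[OF xt] Ht eS[OF xt(2,3)] unfolding w_def[symmetric] w'_def[symmetric] by linarith
      then have "0 < (w' - w) / h" using pr(2) by linarith
      then have ww': "w \<le> w'" using h by (simp add: zero_less_divide_iff)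
      have w0: "0 < w" using wS pr(3) by linarith
      have m1: "1 \<le> 1 / m" using mp by simp
      have "(2 + 2 powr (p / m)) * S t powr (p / m) = 1 / m * (S t / 2) powr (1 / m - 1) * (S' t / 2)"
      proof -
        have "1 / m * (S t / 2) powr (1 / m - 1) * (S' t / 2)
            = (1 / m * S t powr (1 / m - 1) * S' t) / (2 powr (1 / m - 1) * 2)"
          using pr(3) by (simp add: powr_divide)
        also have "2 powr (1 / m - 1) * 2 = (2::real) powr (1 / m)" by (simp add: powr_diff)
        finally show ?thesis unfolding pr(4) by (simp add: c_def)
      qed
      also have "\<dots> \<le> 1 / m * w powr (1 / m - 1) * ((w' - w) / h)"
        using wS pr(2,3) m1 mp quot by (intro mult_mono mult_left_mono powr_mono2) auto
      also have "\<dots> \<le> (u x (t + h) - u x t) / h"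
        unfolding uw times_divide_eq_right
        by (rule divide_right_mono[OF powr_tangent(1)[OF w0 ww' m1]]) (use h in simp)
      finally have low: "(2 + 2 powr (p / m)) * S t powr (p / m) \<le> (u x (t + h) - u x t) / h" .
      have Sp: "1 \<le> S t powr (p / m)" using pr(3) mp by (intro ge_one_powr_ge_zero) auto
      \<comment> \<open>Far out the quadratic term allows w to be much larger than S, so S does not
        control the reaction, but there the source is absent. Nearer the ball, w \<le> 2 S.\<close>
      have "(u x (t + h) - u x t) / h \<le> 1 / 2 + (2 * S t) powr (p / m)"
      proof (cases "L + 1 \<le> norm x")
        case True
        then show ?thesis using F2[OF xt(1) True xt(2,3)] sumD2 e powr_ge_zero[of "2 * S t" "p / m"] by linarith
      next
        case False
        then have "(norm x)\<^sup>2 \<le> (L + 1)\<^sup>2" by (intro power_mono) auto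
        then have "\<epsilon> * (x \<bullet> x) \<le> \<epsilon> * (L + 1)\<^sup>2" using \<epsilon> by (simp add: power2_norm_eq_inner)
        then have "w \<le> 2 * S t" using Aw' Sx e pr(3) \<epsilon>(3) by linarith
        moreover have "u x t powr p = w powr (p / m)" using uw(1) by (simp add: powr_powr)
        ultimately have "u x t powr p \<le> (2 * S t) powr (p / m)"
          using w0 mp by (simp add: powr_mono2)
        then show ?thesis using F1[OF xt] sumD2 e by linarith
      qed
      also have "(2 * S t) powr (p / m) = 2 powr (p / m) * S t powr (p / m)"
        using pr(3) by (simp add: powr_mult)
      finally show False using low Sp by (simp add: algebra_simps)
    qed
    have xR: "norm x \<le> R" using x R(1) by simp
    have "(norm x)\<^sup>2 \<le> (L + 1)\<^sup>2" using x L by (intro power_mono) auto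
    then have "\<epsilon> * (x \<bullet> x) \<le> \<epsilon> * (L + 1)\<^sup>2" using \<epsilon> by (simp add: power2_norm_eq_inner)
    then have "u x T powr m \<le> 2 * S T"
      using touching[OF xR T order_refl] Aw[OF xR T order_refl] \<epsilon>(3) e prof(3)[of T] T
      unfolding H_def by linarith
    then have "(u x T powr m) powr (1 / m) \<le> (2 * S T) powr (1 / m)"
      using mp by (intro powr_mono2) auto
    then show ?thesis using u0[of T x] T mp by (simp add: powr_powr)
  qed
  define C where "C = 2 powr (1 / m) * (G + (1 - p) * c) powr q"
  show ?thesis
  proof (rule that[of C])
    have pos: "0 < G + (1 - p) * c" using G(1) mp c by (simp add: add_pos_pos)
    then show "0 < C" by (simp add: C_def)
    fix x :: "real^'n" and t :: real assume t: "1 \<le> t" and x: "norm x \<le> L"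
    have t0: "0 \<le> t" using t by simp
    note Bt = B1[OF t0]
    have "u x t \<le> (2 * S t) powr (1 / m)" by (rule main[OF t x])
    also have "\<dots> = 2 powr (1 / m) * B t powr q"
      using prof(3,5)[OF t0] by (simp add: powr_mult)
    also have "B t \<le> (G + (1 - p) * c) * t"
      unfolding B_def using t G(1) by (simp add: algebra_simps mult_le_cancel_left1)
    then have "B t powr q \<le> ((G + (1 - p) * c) * t) powr q"
      using Bt q by (intro powr_mono2) auto
    also have "((G + (1 - p) * c) * t) powr q = (G + (1 - p) * c) powr q * t powr q"
      using pos t by (simp add: powr_mult)
    finally show "u x t \<le> C * t powr (1 / (1 - p))" by (simp add: C_def q_def mult.assoc)
  qed
qed

section \<open>Comparison from below on a ball inside the source\<close>

text \<open>The square makes \<open>\<Delta>\<rho>\<^sup>2\<close> nonnegative near the boundary, where the reaction is too weak to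
  compensate for diffusion.\<close>

lemma square_profile_laplacian:
  fixes N R \<rho> s p' \<sigma> :: real
  assumes "0 \<le> N" "0 < R" "\<rho> \<le> 1" "0 \<le> \<rho>" "s = R\<^sup>2 * (1 - \<rho>)" "1 < p'" "0 < \<sigma>"
    and "8 * N / (R\<^sup>2 * (2 / (2 + N)) powr (2 * p')) \<le> \<sigma> powr (p' - 1)"
  shows "- ((\<sigma> * \<rho>\<^sup>2) powr p' / 2) \<le> \<sigma> * (8 * s / R ^ 4 - 4 * N * \<rho> / R\<^sup>2)"
proof -
  have e: "8 * s / R ^ 4 - 4 * N * \<rho> / R\<^sup>2 = (8 - (8 + 4 * N) * \<rho>) / R\<^sup>2"
    using assms(2,5) by (simp add: field_simps power2_eq_square power4_eq_xxxx)
  \<comment> \<open>2 / (2 + N) is the zero of 8 - (8 + 4 N) \<rho>, which carries the sign of the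
    Laplacian of \<sigma> \<rho>^2. Below it the Laplacian is nonnegative; above it \<rho> is
    bounded below, and the size condition on \<sigma> makes half of the reaction outweigh the worst
    value -4 N \<sigma> / R^2.\<close>
  show ?thesis
  proof (cases "\<rho> \<le> 2 / (2 + N)")
    case True
    then have "(8 + 4 * N) * \<rho> \<le> 8" using assms(1) by (simp add: field_simps)
    then have "0 \<le> \<sigma> * (8 * s / R ^ 4 - 4 * N * \<rho> / R\<^sup>2)" unfolding e using assms(7) by simp
    moreover have "0 \<le> (\<sigma> * \<rho>\<^sup>2) powr p' / 2" by simp
    ultimately show ?thesis by linarith
  next
    case False
    define \<kappa> where "\<kappa> = (2 / (2 + N)) powr (2 * p')"
    have \<kappa>: "0 < \<kappa>" using assms(1) by (simp add: \<kappa>_def)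
    have \<rho>0: "0 < \<rho>" using False assms(1) by (smt (verit) divide_pos_pos)
    have "\<kappa> \<le> \<rho> powr (2 * p')"
      unfolding \<kappa>_def using False assms(1,6) by (intro powr_mono2) auto
    moreover have "8 * N / R\<^sup>2 \<le> \<sigma> powr (p' - 1) * \<kappa>"
      using assms(8)[folded \<kappa>_def] \<kappa> assms(2) by (simp add: field_simps)
    ultimately have "8 * N / R\<^sup>2 \<le> \<sigma> powr (p' - 1) * \<rho> powr (2 * p')"
      by (meson mult_left_mono order_trans powr_ge_zero)
    then have "\<sigma> * (8 * N / R\<^sup>2) \<le> \<sigma> * (\<sigma> powr (p' - 1) * \<rho> powr (2 * p'))"
      using assms(7) by (intro mult_left_mono) auto
    also have "\<dots> = (\<sigma> * \<rho>\<^sup>2) powr p'"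
      using assms(7) \<rho>0 by (simp add: powr_mult powr_diff powr_powr powr_numeral[symmetric] del: powr_numeral)
    finally have "\<sigma> * (8 * N / R\<^sup>2) \<le> (\<sigma> * \<rho>\<^sup>2) powr p'" .
    moreover have "\<sigma> * (8 * N / R\<^sup>2) = 2 * (\<sigma> * (4 * N / R\<^sup>2))" by simp
    ultimately have "- ((\<sigma> * \<rho>\<^sup>2) powr p' / 2) \<le> \<sigma> * (- (4 * N / R\<^sup>2))"
      unfolding mult_minus_right by linarith
    also have "\<dots> \<le> \<sigma> * (8 * s / R ^ 4 - 4 * N * \<rho> / R\<^sup>2)"
    proof (rule mult_left_mono)
      have "- (4 * N) \<le> 8 * (1 - \<rho>) - 4 * N * \<rho>"
        using assms(1,3) mult_left_mono[of \<rho> 1 "4 * N"] by simp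
      then have "- (4 * N) \<le> 8 - (8 + 4 * N) * \<rho>" by (simp add: algebra_simps)
      then show "- (4 * N / R\<^sup>2) \<le> 8 * s / R ^ 4 - 4 * N * \<rho> / R\<^sup>2"
        unfolding e using assms(2) divide_right_mono[of "- (4 * N)" "8 - (8 + 4 * N) * \<rho>" "R\<^sup>2"] by simp
    qed (use assms(7) in simp)
    finally show ?thesis .
  qed
qed

text \<open>The barrier only has to be positive at \<open>x\<^sub>0\<close>, so R may lie strictly
  between its norm and L. Grow-up acts at all times after T0: it orders the functions initially and
  on the sphere, and it keeps the value at a contact point away from 0.\<close>

lemma lower_bound:
  fixes u :: "real^'n \<Rightarrow> real \<Rightarrow> real" and x\<^sub>0 :: "real^'n"
  assumes sol: "global_weak_solution m p L u0 u" and grow: "tends_to_infinity_locally_uniformly u"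
    and mp: "0 < m" "m < p" "p < 1" and x0: "norm x\<^sub>0 < L"
  obtains c where "0 < c" "\<forall>\<^sub>F t in at_top. c * t powr (1 / (1 - p)) \<le> u x\<^sub>0 t"
proof -
  define R where "R = (norm x\<^sub>0 + L) / 2"
  have R: "0 < R" "R < L" "norm x\<^sub>0 < R" using x0 norm_ge_zero[of x\<^sub>0] by (auto simp: R_def simp del: norm_ge_zero)
  define N where "N = real CARD('n)"
  have N: "0 < N" by (simp add: N_def)
  define q where "q = 1 / (1 - p)"
  have q: "0 < q" using mp by (simp add: q_def)
  have p0: "0 < p" using mp by simp
  have m1: "1 \<le> 1 / m" "0 \<le> 1 / m - 1" using mp by simp_all
  have pm: "1 < p / m" using mp by simp
  \<comment> \<open>With Z the barrier at contact and Y = Z^(p/m), this makes the time derivative of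
    the barrier cost at most Y / 16; the power of 2 compensates for evaluating the slope at 2
    Z.\<close>
  define c where "c = 1 / (16 * 2 powr (1 / m))"
  have c: "0 < c" by (simp add: c_def)
  define \<kappa> where "\<kappa> = 8 * N / (R\<^sup>2 * (2 / (2 + N)) powr (2 * (p / m)))"
  have \<kappa>: "0 \<le> \<kappa>" unfolding \<kappa>_def using N by simp
  \<comment> \<open>From S0 on, the size condition of \<open>square_profile_laplacian\<close> holds;
    p > m makes the exponent p / m - 1 positive, and the + 1 gives S0 \<ge> 1.\<close>
  define S0 where "S0 = (\<kappa> + 1) powr (1 / (p / m - 1))"
  have S0: "1 \<le> S0" "\<kappa> \<le> S0 powr (p / m - 1)"
    using \<kappa> pm by (auto simp: S0_def powr_powr ge_one_powr_ge_zero)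
  define G0 where "G0 = S0 powr (1 / (q * m))"
  have G0: "1 \<le> G0" "G0 powr (q * m) = S0"
    using S0 q mp by (auto simp: G0_def powr_powr ge_one_powr_ge_zero)
  have "\<forall>\<^sub>F t in at_top. \<forall>x\<in>cball 0 L. (S0 + 3) powr (1 / m) < u x t"
    using grow unfolding tends_to_infinity_locally_uniformly_def by (meson compact_cball)
  then obtain T0' where "\<forall>t\<ge>T0'. \<forall>x\<in>cball 0 L. (S0 + 3) powr (1 / m) < u x t"
    unfolding eventually_at_top_linorder by blast
  then have T0': "(S0 + 3) powr (1 / m) < u x t" if "T0' \<le> t" "norm x \<le> L" for x t
    using that by simp
  define T0 where "T0 = max T0' 1"
  have T0: "1 \<le> T0" by (simp add: T0_def)
  have big: "S0 + 3 \<le> u x t powr m" if "T0 \<le> t" "norm x \<le> L" for x t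
  proof -
    have "(S0 + 3) powr (1 / m) \<le> u x t" using T0'[of t x] that by (simp add: T0_def)
    then have "((S0 + 3) powr (1 / m)) powr m \<le> u x t powr m" using mp by (intro powr_mono2) auto
    then show ?thesis using S0 mp by (simp add: powr_powr)
  qed
  have u0: "0 \<le> u x t" if "0 \<le> t" for x t
    using sol that by (simp add: global_weak_solution_def)
  \<comment> \<open>A time shift that starts the profile at S0 at time T0. G may be negative; only
    from T0 on must the base be at least 1.\<close>
  define G where "G = G0 - (1 - p) * c * T0"
  define B where "B = (\<lambda>t. G + (1 - p) * c * t)"
  define S where "S = (\<lambda>t. B t powr (q * m))"
  define S' where "S' = (\<lambda>t. m * c * B t powr (q * m - 1))"
  have Bmono: "B s \<le> B t" if "s \<le> t" for s t
    unfolding B_def using that mp c by simp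
  have BT0: "B T0 = G0" by (simp add: B_def G_def)
  have B1: "1 \<le> B t" if "T0 \<le> t" for t
    using Bmono[OF that] BT0 G0 by simp
  have prof: "(S has_real_derivative S' t) (at t)" "0 < S' t" "1 \<le> S t"
    "1 / m * S t powr (1 / m - 1) * S' t = c * S t powr (p / m)"
    "S t powr (1 / m) = B t powr q" if "T0 \<le> t" for t
    unfolding S_def S'_def B_def q_def
    by (rule grow_up_profile[OF mp c B1[OF that, unfolded B_def]])+
  have ST0: "S T0 = S0" unfolding S_def BT0 by (rule G0(2))
  have Smono: "S s \<le> S t" if "T0 \<le> s" "s \<le> t" for s t
    unfolding S_def using Bmono[OF that(2)] B1[OF that(1)] q mp by (intro powr_mono2) auto
  define \<rho> where "\<rho> = (\<lambda>x::real^'n. 1 - (x \<bullet> x) / R\<^sup>2)"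
  have \<rho>: "0 \<le> \<rho> x" "\<rho> x \<le> 1" if "norm x \<le> R" for x
  proof -
    have "x \<bullet> x \<le> R\<^sup>2" using power_mono[OF that, of 2] by (simp add: power2_norm_eq_inner)
    then show "0 \<le> \<rho> x" using R by (simp add: \<rho>_def)
    show "\<rho> x \<le> 1" by (simp add: \<rho>_def)
  qed
  have main: "S T * (\<rho> x)\<^sup>2 \<le> u x T powr m + 1 / 8" if T: "T0 \<le> T" and x: "norm x \<le> R" for x T
  proof -
    \<comment> \<open>With e \<le> r, the error times the largest slope, taken at 2 S T, is at most
      1/8; with e \<le> r', replacing Z by (1 - e) Z costs at most an eighth of the
      reaction.\<close>
    define r where "r = 1 / (1 / m * (2 * S T) powr (1 / m - 1)) / 8"
    have rpos: "0 < 1 / m * (2 * S T) powr (1 / m - 1)" using mp prof(3)[OF T] by simp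
    then have r: "0 < r" unfolding r_def by (intro divide_pos_pos) auto
    define r' where "r' = 1 - (7 / 8) powr (m / p)"
    have "(7 / 8) powr (m / p) < 1 powr (m / p)" using mp by (intro powr_less_mono2) auto
    then have r': "0 < r'" by (simp add: r'_def)
    define e where "e = min (1 / 16) (min r r')"
    have e: "0 < e" "e \<le> 1 / 16" "e \<le> r" "e \<le> r'" using r r' by (auto simp: e_def)
    have e78: "7 / 8 \<le> (1 - e) powr (p / m)"
    proof -
      have "((7 / 8) powr (m / p)) powr (p / m) \<le> (1 - e) powr (p / m)"
        using e pm by (intro powr_mono2) (auto simp: r'_def)
      then show ?thesis using mp by (simp add: powr_powr)
    qed
    obtain A At :: "real^'n \<Rightarrow> real \<Rightarrow> real" and D1 D2 :: "'n \<Rightarrow> real^'n \<Rightarrow> real \<Rightarrow> real" and h :: real where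
      h: "0 < h"
      and At: "\<And>x t. ((\<lambda>s. A x s) has_real_derivative At x t) (at t)"
      and D1: "\<And>i x t. ((\<lambda>r. A (x + r *\<^sub>R axis i 1) t) has_real_derivative D1 i x t) (at 0)"
      and D2: "\<And>i x t. ((\<lambda>r. D1 i (x + r *\<^sub>R axis i 1) t) has_real_derivative D2 i x t) (at 0)"
      and contA: "continuous_on UNIV (\<lambda>z. A (fst z) (snd z))"
      and Aw: "\<And>x t. norm x \<le> R \<Longrightarrow> T0 \<le> t \<Longrightarrow> t \<le> T \<Longrightarrow> \<bar>A x t - u x t powr m\<bar> \<le> e"
      and Atw: "\<And>x t. norm x \<le> R \<Longrightarrow> T0 \<le> t \<Longrightarrow> t \<le> T \<Longrightarrow>
           \<bar>At x t - (u x (t + h) powr m - u x t powr m) / h\<bar> \<le> e"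
      and F3: "\<And>x t. norm x \<le> R \<Longrightarrow> norm x \<le> R \<Longrightarrow> T0 \<le> t \<Longrightarrow> t \<le> T \<Longrightarrow>
           u x t powr p - e \<le> (u x (t + h) - u x t) / h - (\<Sum>i\<in>UNIV. D2 i x t)"
      and wh: "\<And>x t. norm x \<le> R \<Longrightarrow> T0 \<le> t \<Longrightarrow> t \<le> T \<Longrightarrow> \<bar>u x (t + h) powr m - u x t powr m\<bar> \<le> e"
      by (rule approximation[OF sol mp(1) p0 less_le_trans[OF zero_less_one T0] e(1) R(2), where R = R and T = T]) (rule that)
    define H where "H = (\<lambda>x t. S t * (\<rho> x)\<^sup>2 - A x t)"
    define Z1 where "Z1 = (\<lambda>i x t. S t * (2 * \<rho> x * (- (2 * x $ i) / R\<^sup>2)))"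
    define Z2 where "Z2 = (\<lambda>i x t. S t * (8 * (x $ i)\<^sup>2 / R ^ 4 - 4 * \<rho> x / R\<^sup>2))"
    have d\<rho>: "((\<lambda>r. \<rho> (x + r *\<^sub>R axis i 1)) has_real_derivative - (2 * x $ i) / R\<^sup>2) (at 0)" for x i
      unfolding \<rho>_def using DERIV_diff[OF DERIV_const DERIV_cdivide[OF norm_square_axis_derivative]] by simp
    have d1: "((\<lambda>r. S t * (\<rho> (x + r *\<^sub>R axis i 1))\<^sup>2) has_real_derivative Z1 i x t) (at 0)" for i x t
      unfolding Z1_def using DERIV_cmult[OF DERIV_power[OF d\<rho>[of x i], of 2], of "S t"] by (simp add: mult_ac)
    have d2: "((\<lambda>r. Z1 i (x + r *\<^sub>R axis i 1) t) has_real_derivative Z2 i x t) (at 0)" for i x t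
    proof -
      have "((\<lambda>r. - (2 * (x + r *\<^sub>R axis i 1) $ i) / R\<^sup>2) has_real_derivative - 2 / R\<^sup>2) (at 0)"
        by (rule DERIV_cdivide) (auto intro!: derivative_eq_intros)
      from DERIV_mult[OF DERIV_cmult[OF d\<rho>[of x i], of 2] this]
      have "((\<lambda>r. 2 * \<rho> (x + r *\<^sub>R axis i 1) * (- (2 * (x + r *\<^sub>R axis i 1) $ i) / R\<^sup>2)) has_real_derivative
         8 * (x $ i)\<^sup>2 / R ^ 4 - 4 * \<rho> x / R\<^sup>2) (at 0)"
        by (rule DERIV_cong) (use R in \<open>simp add: field_simps power2_eq_square power4_eq_xxxx\<close>)
      then show ?thesis unfolding Z1_def Z2_def by (rule DERIV_cmult)
    qed
    have touching: "H y t < 0" if yt: "norm y \<le> R" "T0 \<le> t" "t \<le> T" for y t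
    proof (rule parabolic_touching[of R T0 T H "\<lambda>x t. S' t * (\<rho> x)\<^sup>2 - At x t" "\<lambda>i x t. Z1 i x t - D1 i x t"
          "\<lambda>i x t. Z2 i x t - D2 i x t", OF _ _ _ _ _ _ _ yt])
      have "continuous_on {T0..T} S"
        by (rule DERIV_continuous_on[of _ _ S']) (use prof(1) in \<open>auto intro: has_field_derivative_at_within\<close>)
      then have "continuous_on (cball 0 R \<times> {T0..T}) (\<lambda>z. S (snd z))"
        by (rule continuous_on_compose2) (auto intro!: continuous_intros)
      then show "continuous_on (cball 0 R \<times> {T0..T}) (\<lambda>z. H (fst z) (snd z))"
        unfolding H_def \<rho>_def using R by (intro continuous_intros continuous_on_subset[OF contA]) auto
    next
      fix x t assume t: "T0 \<le> t" "t \<le> T"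
      show "((\<lambda>s. H x s) has_real_derivative S' t * (\<rho> x)\<^sup>2 - At x t) (at t)"
        unfolding H_def by (rule DERIV_diff[OF DERIV_cmult_right[OF prof(1)[OF t(1)]] At])
      fix i
      show "((\<lambda>r. H (x + r *\<^sub>R axis i 1) t) has_real_derivative Z1 i x t - D1 i x t) (at 0)"
        unfolding H_def by (rule DERIV_diff[OF d1 D1])
      show "((\<lambda>r. Z1 i (x + r *\<^sub>R axis i 1) t - D1 i (x + r *\<^sub>R axis i 1) t) has_real_derivative Z2 i x t - D2 i x t) (at 0)"
        by (rule DERIV_diff[OF d2 D2])
    next
      fix x :: "real^'n" assume x: "norm x \<le> R"
      have "S T0 * (\<rho> x)\<^sup>2 \<le> S0 * 1"
        unfolding ST0 using \<rho>[OF x] S0 by (intro mult_left_mono power_le_one) auto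
      moreover have "S0 + 3 \<le> u x T0 powr m" using x R by (intro big) auto
      ultimately show "H x T0 < 0"
        using Aw[OF x order_refl T] e unfolding H_def by linarith
    next
      fix x :: "real^'n" and t assume x: "norm x = R" and t: "T0 \<le> t" "t \<le> T"
      have "x \<bullet> x = R\<^sup>2" using x by (simp add: power2_norm_eq_inner[symmetric])
      then have "\<rho> x = 0" using R by (simp add: \<rho>_def)
      moreover have "S0 + 3 \<le> u x t powr m" using x R t by (intro big) auto
      ultimately show "H x t < 0"
        using Aw[OF eq_refl[OF x] t] e S0 unfolding H_def by simp
    next
      fix x :: "real^'n" and t assume x: "norm x < R" and t: "T0 < t" "t \<le> T" and H0: "H x t = 0"
        and Ht: "0 \<le> S' t * (\<rho> x)\<^sup>2 - At x t" and H2: "\<And>i. Z2 i x t - D2 i x t \<le> 0"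
      have xt: "norm x \<le> R" "T0 \<le> t" "t \<le> T" using x t by auto
      note pr = prof[OF xt(2)]
      have t0: "0 \<le> t" using xt T0 by simp
      define w where "w = u x t powr m"
      define w' where "w' = u x (t + h) powr m"
      define Z where "Z = S t * (\<rho> x)\<^sup>2"
      define Y where "Y = Z powr (p / m)"
      have uw: "u x t = w powr (1 / m)" "u x (t + h) = w' powr (1 / m)"
        using u0[of t x] u0[of "t + h" x] t0 h mp by (auto simp: w_def w'_def powr_powr)
      have AZ: "A x t = Z" using H0 by (simp add: H_def Z_def)
      have Zw: "\<bar>Z - w\<bar> \<le> e" using Aw[OF xt] by (simp add: w_def AZ)
      \<comment> \<open>Grow-up makes the contact value at least 1. This turns absolute errors into
        relative ones and excludes points where \<rho> vanishes.\<close>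
      have "S0 + 3 \<le> w" unfolding w_def using xt R by (intro big) auto
      then have Z1: "1 \<le> Z" and w1: "1 \<le> w" using Zw e S0 by linarith+
      have Y1: "1 \<le> Y" unfolding Y_def using Z1 pm by (intro ge_one_powr_ge_zero) auto
      have \<rho>x: "0 < \<rho> x"
        using Z1 \<rho>(1)[OF xt(1)] by (cases "\<rho> x = 0") (auto simp: Z_def)
      have ZS: "Z \<le> S T"
      proof -
        have "Z \<le> S t * 1" unfolding Z_def
          using \<rho>[OF xt(1)] pr(3) by (intro mult_left_mono power_le_one) auto
        then show ?thesis using Smono[OF xt(2,3)] by simp
      qed
      have lap: "- (Y / 2) \<le> (\<Sum>i\<in>UNIV. D2 i x t)"
      proof -
        have xx: "x \<bullet> x = R\<^sup>2 * (1 - \<rho> x)" using R by (simp add: \<rho>_def)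
        have "\<kappa> \<le> S t powr (p / m - 1)"
        proof -
          have "S0 powr (p / m - 1) \<le> S t powr (p / m - 1)"
            using Smono[OF order_refl xt(2)] S0 pm ST0 by (intro powr_mono2) auto
          then show ?thesis using S0(2) by linarith
        qed
        then have "- (Y / 2) \<le> S t * (8 * (x \<bullet> x) / R ^ 4 - 4 * N * \<rho> x / R\<^sup>2)"
          unfolding Y_def Z_def using pr(3) N R \<rho>[OF xt(1)] pm xx
          by (intro square_profile_laplacian) (auto simp: \<kappa>_def)
        also have "\<dots> = (\<Sum>i\<in>UNIV. Z2 i x t)"
        proof -
          have "x \<bullet> x = (\<Sum>i\<in>UNIV. (x $ i)\<^sup>2)" by (simp add: inner_vec_def power2_eq_square)
          then show ?thesis
            by (simp add: Z2_def N_def sum_distrib_left[symmetric] sum_subtractf sum_divide_distrib[symmetric])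
        qed
        also have "\<dots> \<le> (\<Sum>i\<in>UNIV. D2 i x t)" using H2 by (intro sum_mono) simp
        finally show ?thesis .
      qed
      have react: "7 / 8 * Y \<le> u x t powr p"
      proof -
        have "(1 - e) * Z \<le> w"
        proof -
          have "e * 1 \<le> e * Z" using Z1 e by (intro mult_left_mono) auto
          moreover have "(1 - e) * Z = Z - e * Z" by (simp add: left_diff_distrib)
          ultimately show ?thesis using Zw by linarith
        qed
        then have "((1 - e) * Z) powr (p / m) \<le> w powr (p / m)"
          using e Z1 pm by (intro powr_mono2) auto
        moreover have "7 / 8 * Y \<le> ((1 - e) * Z) powr (p / m)"
          unfolding Y_def using e Z1 e78 by (simp add: powr_mult mult_right_mono)
        moreover have "u x t powr p = w powr (p / m)" using uw(1) by (simp add: powr_powr)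
        ultimately show ?thesis by simp
      qed
      \<comment> \<open>7/8 from the reaction, less 1/2 for diffusion and less e \<le> Y /
        16.\<close>
      have low: "5 / 16 * Y \<le> (u x (t + h) - u x t) / h"
        using F3[OF xt(1,1,2,3)] lap react e Y1 by linarith
      \<comment> \<open>The monotonicity needed for the tangent inequality comes from the equation
        here, not from the growth of the barrier as in the comparison from above.\<close>
      then have "0 < (u x (t + h) - u x t) / h" using Y1 by linarith
      then have "u x t < u x (t + h)" using h by (simp add: zero_less_divide_iff)
      then have ww': "w \<le> w'" unfolding w_def w'_def using u0[OF t0, of x] mp by (intro powr_mono2) auto
      have "w' \<le> w + e" using wh[OF xt] unfolding w_def w'_def by linarith
      then have w'Z: "w' \<le> 2 * Z" using Zw e Z1 by linarith
      have quot: "(w' - w) / h \<le> S' t * (\<rho> x)\<^sup>2 + e"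
        using Atw[OF xt] Ht unfolding w_def[symmetric] w'_def[symmetric] by linarith
      have "0 < w" using w1 by simp
      have "(u x (t + h) - u x t) / h \<le> 1 / m * w' powr (1 / m - 1) * ((w' - w) / h)"
        unfolding uw times_divide_eq_right
        by (rule divide_right_mono[OF powr_tangent(2)[OF \<open>0 < w\<close> ww' m1(1)]]) (use h in simp)
      also have "\<dots> \<le> 1 / m * (2 * Z) powr (1 / m - 1) * (S' t * (\<rho> x)\<^sup>2 + e)"
        using w'Z ww' w1 m1 mp quot h by (intro mult_mono mult_left_mono powr_mono2) auto
      also have "\<dots> = 1 / m * (2 * Z) powr (1 / m - 1) * (S' t * (\<rho> x)\<^sup>2) + 1 / m * (2 * Z) powr (1 / m - 1) * e"
        by (simp only: distrib_left)
      also have "1 / m * (2 * Z) powr (1 / m - 1) * e \<le> 1 / m * (2 * S T) powr (1 / m - 1) * r"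
        using ZS Z1 m1 mp e by (intro mult_mono mult_left_mono powr_mono2) auto
      also have "1 / m * (2 * S T) powr (1 / m - 1) * r = 1 / 8"
        unfolding r_def times_divide_eq_right using rpos by (simp only: mult_1_right divide_self[OF less_imp_neq[symmetric]])
      also have "1 / m * (2 * Z) powr (1 / m - 1) * (S' t * (\<rho> x)\<^sup>2) \<le> Y / 16"
      proof -
        have "(2 * Z) powr (1 / m - 1) * (\<rho> x)\<^sup>2 = 2 powr (1 / m - 1) * S t powr (1 / m - 1) * ((\<rho> x)\<^sup>2) powr (1 / m)"
        proof -
          have "((\<rho> x)\<^sup>2) powr (1 / m - 1) * (\<rho> x)\<^sup>2 = ((\<rho> x)\<^sup>2) powr (1 / m)"
            using \<rho>x by (simp add: powr_diff)
          then show ?thesis using pr(3) \<rho>x by (simp add: Z_def powr_mult)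
        qed
        then have "1 / m * (2 * Z) powr (1 / m - 1) * (S' t * (\<rho> x)\<^sup>2)
          = 2 powr (1 / m - 1) * (1 / m * S t powr (1 / m - 1) * S' t) * ((\<rho> x)\<^sup>2) powr (1 / m)"
          by (simp add: mult_ac)
        also have "\<dots> = 2 powr (1 / m - 1) * c * (S t powr (p / m) * ((\<rho> x)\<^sup>2) powr (1 / m))"
          unfolding pr(4) by (simp only: mult_ac)
        \<comment> \<open>This uses p < 1: since \<rho>^2 \<le> 1, lowering its exponent from 1/m to
          p/m enlarges the term, so the reaction controls the time derivative however small \<rho>
          is.\<close>
        also have "\<dots> \<le> 2 powr (1 / m - 1) * c * (S t powr (p / m) * ((\<rho> x)\<^sup>2) powr (p / m))"
        proof -
          have "(\<rho> x)\<^sup>2 \<le> 1" using \<rho>[OF xt(1)] by (intro power_le_one) auto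
          then have "((\<rho> x)\<^sup>2) powr (1 / m) \<le> ((\<rho> x)\<^sup>2) powr (p / m)"
            using \<rho>x mp by (intro powr_mono') (auto simp: divide_right_mono)
          then show ?thesis using c by (intro mult_left_mono) auto
        qed
        also have "S t powr (p / m) * ((\<rho> x)\<^sup>2) powr (p / m) = Y"
          using pr(3) by (simp add: Y_def Z_def powr_mult)
        also have "2 powr (1 / m - 1) * c * Y \<le> Y / 16"
          using Y1 by (simp add: c_def powr_diff)
        finally show ?thesis .
      qed
      \<comment> \<open>Y / 16 + 1/8 cannot reach 5 Y / 16 because Y \<ge> 1.\<close>
      finally show False using low Y1 by linarith
    qed
    show ?thesis
      using touching[OF x T order_refl] Aw[OF x T order_refl] e unfolding H_def by linarith
  qed
  define a where "a = (\<rho> x\<^sub>0)\<^sup>2"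
  have a: "0 < a"
  proof -
    have "(norm x\<^sub>0)\<^sup>2 < R\<^sup>2" using R by (intro power_strict_mono) auto
    then show ?thesis using R by (simp add: a_def \<rho>_def power2_norm_eq_inner field_simps)
  qed
  \<comment> \<open>Half the slope of B, so that b t \<le> B t from 2 T0 on in spite of the time
    shift. The second threshold on t below gives S t * a \<ge> 1, so half of this product absorbs
    the error 1/8.\<close>
  define b where "b = (1 - p) * c / 2"
  have b: "0 < b" using mp c by (simp add: b_def)
  define C where "C = (a / 2) powr (1 / m) * b powr q"
  show ?thesis
  proof (rule that[of C])
    show "0 < C" unfolding C_def using a b by simp
    show "\<forall>\<^sub>F t in at_top. C * t powr (1 / (1 - p)) \<le> u x\<^sub>0 t"
      using eventually_ge_at_top[of "2 * T0"] eventually_ge_at_top[of "(1 / a) powr (1 / (q * m)) / b"]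
    proof eventually_elim
      case (elim t)
      have t: "T0 \<le> t" "0 < t" using elim T0 by auto
      have "b * (2 * T0) \<le> b * t"
        using elim(1) b by (intro mult_left_mono) auto
      moreover have "B t = G0 - b * (2 * T0) + 2 * (b * t)" by (simp add: B_def G_def b_def)
      ultimately have Bb: "b * t \<le> B t" using G0(1) by linarith
      have "(1 / a) powr (1 / (q * m)) \<le> b * t" using elim(2) b by (simp add: pos_divide_le_eq mult.commute)
      then have "(1 / a) powr (1 / (q * m)) \<le> B t" using Bb by linarith
      then have "((1 / a) powr (1 / (q * m))) powr (q * m) \<le> S t"
        unfolding S_def using q mp by (intro powr_mono2) auto
      then have "1 / a \<le> S t" using q mp a by (simp add: powr_powr)
      then have "1 \<le> S t * a" using a by (simp add: field_simps)
      then have "S t * a / 2 \<le> u x\<^sub>0 t powr m"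
        using main[OF t(1), of x\<^sub>0] R unfolding a_def by simp
      then have "(a / 2 * S t) powr (1 / m) \<le> (u x\<^sub>0 t powr m) powr (1 / m)"
        using mp a prof(3)[OF t(1)] by (intro powr_mono2) (auto simp: mult_ac)
      also have "\<dots> = u x\<^sub>0 t" using mp u0[of t x\<^sub>0] t by (simp add: powr_powr)
      also have "(a / 2 * S t) powr (1 / m) = (a / 2) powr (1 / m) * B t powr q"
        by (subst powr_mult) (use a prof(3,5)[OF t(1)] in auto)
      finally have "(a / 2) powr (1 / m) * B t powr q \<le> u x\<^sub>0 t" .
      moreover have "C * t powr q \<le> (a / 2) powr (1 / m) * B t powr q"
      proof -
        have "b powr q * t powr q = (b * t) powr q" using b t by (simp add: powr_mult)
        also have "\<dots> \<le> B t powr q" using Bb b t q by (intro powr_mono2) auto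
        finally show ?thesis unfolding C_def by (simp add: mult.assoc mult_left_mono)
      qed
      ultimately show ?case by (simp add: q_def)
    qed
  qed
qed

theorem theorem1p5:
  fixes m p L :: real
    and u0 :: "real^'n \<Rightarrow> real"
    and u :: "real^'n \<Rightarrow> real \<Rightarrow> real"
  assumes "CARD('n) \<ge> 2"
    and "0 < L"
    and "0 < m" and "m < p"
    and "ereal p < min (sobolev_exponent CARD('n) m) 1"
    and "initial_datum p L u0"
    and "global_grow_up m p L u0 u"
  shows "\<forall>x. norm x < L \<longrightarrow> comparable_at_top (u x) (\<lambda>t. t powr (1 / (1 - p)))"
proof (intro allI impI)
  fix x :: "real^'n" assume x: "norm x < L"
  have p: "p < 1" using assms(5) by (simp add: one_ereal_def)
  have sol: "global_weak_solution m p L u0 u" and grow: "tends_to_infinity_locally_uniformly u"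
    using assms(7) by (auto simp: global_grow_up_def)
  obtain c where c: "0 < c" "\<forall>\<^sub>F t in at_top. c * t powr (1 / (1 - p)) \<le> u x t"
    by (rule lower_bound[OF sol grow assms(3,4) p x])
  obtain C where C: "0 < C" "\<And>x t. 1 \<le> t \<Longrightarrow> norm x \<le> L \<Longrightarrow> u x t \<le> C * t powr (1 / (1 - p))"
    by (rule upper_bound[OF sol assms(3,4) p assms(2)]) (rule that)
  \<comment> \<open>The maximum supplies the order of the two constants that
    \<open>comparable_at_top\<close> asks for.\<close>
  have "\<forall>\<^sub>F t in at_top. c \<le> u x t / t powr (1 / (1 - p)) \<and> u x t / t powr (1 / (1 - p)) \<le> max c C"
    using c(2) eventually_ge_at_top[of 1]
  proof eventually_elim
    case (elim t)
    then have "0 < t powr (1 / (1 - p))" by simp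
    moreover have "u x t \<le> max c C * t powr (1 / (1 - p))"
      using C(2)[of t x] elim x by (smt (verit) max.cobounded2 mult_right_mono powr_ge_zero)
    ultimately show ?case using elim by (simp add: pos_le_divide_eq pos_divide_le_eq)
  qed
  then show "comparable_at_top (u x) (\<lambda>t. t powr (1 / (1 - p)))"
    unfolding comparable_at_top_def using c(1) by (intro exI[of _ c] exI[of _ "max c C"]) auto
qed

end
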